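(* Let $\varphi$ be an Orlicz function, $I=(0,a)$ with $0<a\le\infty$, and $w$ a positive decreasing weight function on $I$. If $w$ is regular, then the classes $\mathcal{M}_{\varphi,w}$ and $M_{\varphi,w}$ coincide and the associated functionals $\|\cdot\|_{\mathcal{M}}$ and $\|\cdot\|_M$ are equivalent.
   Context: An Orlicz function is a convex, strictly increasing $\varphi:\mathbb{R}_+\to\mathbb{R}_+$ with $\varphi(0)=0$. "Decreasing" means non-increasing. $L^0$ is the set of Lebesgue measurable $f:I\to\mathbb{R}$. For $f\in L^0$, $d_f(s)=|\{t\in I:|f(t)|>s\}|$ and $f^*(t)=\inf\{s\ge0:d_f(s)\le t\}$, $t\in I$ ($\inf\emptyset=\infty$). A weight function is a non-negative decreasing function in $L^0$; $W(t)=\int_0^tw$. $w$ is regular if there is $C>0$ with $W(u)\le Cuw(u)$ for all $u\in I$. $g\prec f$ means $\int_0^tg^*\le\int_0^tf^*$ for all $t\in I$. $M(f)=\int_I\varphi(f^*/w)w$; $M_{\varphi,w}=\{f\in L^0:M(\lambda f)<\infty\text{ for some }\lambda>0\}$; $\|f\|_M=\inf\{\epsilon>0:M(f/\epsilon)\le1\}$. $P(f)=\inf\{\int_I\varphi(|f|/v)v: v\prec w,\ v\ge0\}$, with the convention that where $v(t)=0$ the integrand is $0$ if $f(t)=0$ and $\infty$ if $f(t)\ne0$; $\|f\|_{\mathcal{M}}=\inf\{\epsilon>0:P(f/\epsilon)\le1\}$ and $\mathcal{M}_{\varphi,w}=\{f\in L^0:\|f\|_{\mathcal{M}}<\infty\}$.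 Two functionals $A,B$ are equivalent if there is $C>0$ with $C^{-1}A\le B\le CA$. *)

theory Defs
  imports "HOL-Analysis.Analysis"
begin

text \<open>Real-valued functions on \<open>I\<close> are total functions \<^typ>\<open>real \<Rightarrow> real\<close>; nothing below depends on
  their values outside \<open>I\<close>.  Functionals that may be infinite take values in \<^typ>\<open>ennreal\<close>, where
  the infimum of the empty set is \<open>\<infinity>\<close>.\<close>

definition orlicz_function :: "(real \<Rightarrow> real) \<Rightarrow> bool" where
  "orlicz_function \<phi> \<longleftrightarrow> convex_on {0..} \<phi> \<and> strict_mono_on {0..} \<phi> \<and> \<phi> 0 = 0"

text \<open>A decreasing rearrangement may be infinite, so \<open>\<phi>\<close> is extended by \<open>\<phi>(\<infinity>) = \<infinity>\<close>, which is its
  limit at \<open>\<infinity>\<close>.\<close>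

definition orlicz_ext :: "(real \<Rightarrow> real) \<Rightarrow> ennreal \<Rightarrow> ennreal" where
  "orlicz_ext \<phi> x = (if x = \<infinity> then \<infinity> else ennreal (\<phi> (enn2real x)))"

definition L0 :: "real set \<Rightarrow> (real \<Rightarrow> real) set" where
  "L0 I = borel_measurable (lebesgue_on I)"

definition distribution_function :: "real set \<Rightarrow> (real \<Rightarrow> real) \<Rightarrow> real \<Rightarrow> ennreal" where
  "distribution_function I f s = emeasure lebesgue {t \<in> I. \<bar>f t\<bar> > s}"

definition rearrangement :: "real set \<Rightarrow> (real \<Rightarrow> real) \<Rightarrow> real \<Rightarrow> ennreal" where
  "rearrangement I f t =
     (INF s \<in> {s. 0 \<le> s \<and> distribution_function I f s \<le> ennreal t}. ennreal s)"

definition weight_function :: "real set \<Rightarrow> (real \<Rightarrow> real) \<Rightarrow> bool" where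
  "weight_function I w \<longleftrightarrow> w \<in> L0 I \<and> (\<forall>t\<in>I. 0 \<le> w t) \<and> antimono_on I w"

definition primitive :: "(real \<Rightarrow> real) \<Rightarrow> real \<Rightarrow> ennreal" where
  "primitive w t = (\<integral>\<^sup>+ s. ennreal (w s) \<partial>lebesgue_on {0<..<t})"

definition regular_weight :: "real set \<Rightarrow> (real \<Rightarrow> real) \<Rightarrow> bool" where
  "regular_weight I w \<longleftrightarrow> (\<exists>C>0. \<forall>u\<in>I. primitive w u \<le> ennreal (C * u * w u))"

definition submajorized :: "real set \<Rightarrow> (real \<Rightarrow> real) \<Rightarrow> (real \<Rightarrow> real) \<Rightarrow> bool" where
  "submajorized I g f \<longleftrightarrow>
     (\<forall>t\<in>I. (\<integral>\<^sup>+ s. rearrangement I g s \<partial>lebesgue_on {0<..<t})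
          \<le> (\<integral>\<^sup>+ s. rearrangement I f s \<partial>lebesgue_on {0<..<t}))"


subsection \<open>The class \<open>M\<^bsub>\<phi>,w\<^esub>\<close>\<close>

definition M_modular ::
    "real set \<Rightarrow> (real \<Rightarrow> real) \<Rightarrow> (real \<Rightarrow> real) \<Rightarrow> (real \<Rightarrow> real) \<Rightarrow> ennreal" where
  "M_modular I \<phi> w f =
     (\<integral>\<^sup>+ t. orlicz_ext \<phi> (rearrangement I f t / ennreal (w t)) * ennreal (w t) \<partial>lebesgue_on I)"

definition M_class :: "real set \<Rightarrow> (real \<Rightarrow> real) \<Rightarrow> (real \<Rightarrow> real) \<Rightarrow> (real \<Rightarrow> real) set" where
  "M_class I \<phi> w = {f \<in> L0 I. \<exists>l>0. M_modular I \<phi> w (\<lambda>t. l * f t) < \<infinity>}"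

definition M_norm ::
    "real set \<Rightarrow> (real \<Rightarrow> real) \<Rightarrow> (real \<Rightarrow> real) \<Rightarrow> (real \<Rightarrow> real) \<Rightarrow> ennreal" where
  "M_norm I \<phi> w f = (INF e \<in> {e. 0 < e \<and> M_modular I \<phi> w (\<lambda>t. f t / e) \<le> 1}. ennreal e)"


subsection \<open>The class \<open>\<M>\<^bsub>\<phi>,w\<^esub>\<close>\<close>

definition P_integrand :: "(real \<Rightarrow> real) \<Rightarrow> real \<Rightarrow> real \<Rightarrow> ennreal" where
  "P_integrand \<phi> x y =
     (if y = 0 then (if x = 0 then 0 else \<infinity>) else ennreal (\<phi> (\<bar>x\<bar> / y) * y))"

definition P_modular ::
    "real set \<Rightarrow> (real \<Rightarrow> real) \<Rightarrow> (real \<Rightarrow> real) \<Rightarrow> (real \<Rightarrow> real) \<Rightarrow> ennreal" where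
  "P_modular I \<phi> w f =
     (INF v \<in> {v \<in> L0 I. (\<forall>t\<in>I. 0 \<le> v t) \<and> submajorized I v w}.
        \<integral>\<^sup>+ t. P_integrand \<phi> (f t) (v t) \<partial>lebesgue_on I)"

definition calM_norm ::
    "real set \<Rightarrow> (real \<Rightarrow> real) \<Rightarrow> (real \<Rightarrow> real) \<Rightarrow> (real \<Rightarrow> real) \<Rightarrow> ennreal" where
  "calM_norm I \<phi> w f = (INF e \<in> {e. 0 < e \<and> P_modular I \<phi> w (\<lambda>t. f t / e) \<le> 1}. ennreal e)"

definition calM_class :: "real set \<Rightarrow> (real \<Rightarrow> real) \<Rightarrow> (real \<Rightarrow> real) \<Rightarrow> (real \<Rightarrow> real) set" where
  "calM_class I \<phi> w = {f \<in> L0 I. calM_norm I \<phi> w f < \<infinity>}"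


definition equivalent_functionals_on :: "'f set \<Rightarrow> ('f \<Rightarrow> ennreal) \<Rightarrow> ('f \<Rightarrow> ennreal) \<Rightarrow> bool" where
  "equivalent_functionals_on X A B \<longleftrightarrow>
     (\<exists>C::real. C > 0 \<and> (\<forall>f\<in>X. ennreal (1 / C) * A f \<le> B f \<and> B f \<le> ennreal C * A f))"

end

theory Submission
  imports Defs
begin

text \<open>Regularity makes \<open>w\<close> doubling and makes \<open>W u\<close> comparable to \<open>u * w u\<close>; both estimates
  between the modulars compare dyadic step functions and use that \<open>\<phi> (x / y) * y\<close> decreases in \<open>y\<close>.

  For \<open>P (f / (8 * C)) \<le> M f\<close>, take as competitor \<open>v t = w (b / 2) / (4 * C)\<close> with
  \<open>b = |{|f| \<ge> |f t|}|\<close>. Doubling gives \<open>v\<^sup>* \<le> w\<^sup>*\<close>. If \<open>d\<^sub>k\<close> is the measure of \<open>{|f| \<ge> 2^k}\<close>, the part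
  of \<open>[d\<^sub>k\<^sub>+\<^sub>1, d\<^sub>k)\<close> above \<open>d\<^sub>k / 2\<close> has at least half of its length, and there
  \<open>f\<^sup>* \<ge> 2^k\<close> and \<open>w \<le> w (d\<^sub>k / 2)\<close>.

  Conversely, let \<open>v \<prec> w\<close>. Choose disjoint sets \<open>E\<^sub>k\<close> of measure comparable to \<open>x\<^sub>k = 4^k\<close> on which
  \<open>|f| \<ge> f\<^sup>* x\<^sub>k / 2\<close>. Since \<open>v\<close> integrates over \<open>E\<^sub>k\<close> to at most \<open>W x\<^sub>k \<le> C * x\<^sub>k * w x\<^sub>k\<close>, a Jensen type
  inequality on \<open>E\<^sub>k\<close> bounds the contribution of \<open>[x\<^sub>k, x\<^sub>k\<^sub>+\<^sub>1)\<close> to the modular \<open>M\<close>.\<close>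

subsection \<open>Measure and integration\<close>

lemma sets_borel_is_interval:
  fixes S :: "real set"
  assumes "is_interval S"
  shows "S \<in> sets borel"
  using is_real_interval[OF assms] by auto

lemma sets_lebesgue_borel:
  fixes S :: "'a::euclidean_space set"
  assumes "S \<in> sets borel"
  shows "S \<in> sets lebesgue"
  using sets_completionI_sets[of S lborel] assms by simp

lemma borel_measurable_antimono:
  fixes g :: "real \<Rightarrow> 'b::{linorder_topology, second_countable_topology}"
  assumes "antimono g"
  shows "g \<in> borel_measurable borel"
proof (rule borel_measurableI_greater)
  fix y
  have "is_interval {x. y < g x}"
    unfolding is_interval_1 using assms by (auto simp: antimono_def intro: less_le_trans)
  then show "{x \<in> space borel. y < g x} \<in> sets borel"
    using sets_borel_is_interval by simp
qed

text \<open>Completion keeps the measure of the original sets, so a countable cover by sets of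
  finite measure survives. It gives Tonelli for Lebesgue integrals over measurable subsets.\<close>

lemma sigma_finite_completion:
  assumes "sigma_finite_measure M"
  shows "sigma_finite_measure (completion M)"
proof -
  interpret sigma_finite_measure M by fact
  obtain A :: "nat \<Rightarrow> 'a set" where A: "range A \<subseteq> sets M" "(\<Union>i. A i) = space M"
      "\<And>i. emeasure M (A i) \<noteq> \<infinity>"
    using sigma_finite by metis
  show ?thesis
    by (rule sigma_finite_measure.intro, rule exI[of _ "range A"]) (use A in auto)
qed

lemma sigma_finite_lebesgue_on:
  fixes S :: "'a::euclidean_space set"
  assumes "S \<in> sets lebesgue"
  shows "sigma_finite_measure (lebesgue_on S)"
  using sigma_finite_measure_restrict_space[OF sigma_finite_completion[OF sigma_finite_lborel] assms] .

text \<open>Tonelli for the region under the graph of \<open>g\<close>. The level sets are closed,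
  which is the form that \<open>le_rearrangement\<close> handles.\<close>

lemma (in sigma_finite_measure) nn_integral_layer_cake:
  fixes g :: "'a \<Rightarrow> ennreal"
  assumes g [measurable]: "g \<in> borel_measurable M"
  shows "(\<integral>\<^sup>+ x. g x \<partial>M)
       = (\<integral>\<^sup>+ s. indicator {0<..} s * emeasure M {x \<in> space M. ennreal s \<le> g x} \<partial>lborel)"
proof -
  interpret pair_sigma_finite M lborel
    by (intro pair_sigma_finite.intro sigma_finite_measure_axioms sigma_finite_lborel)
  have len: "g x = (\<integral>\<^sup>+ s. indicator {s. 0 < s \<and> ennreal s \<le> g x} s \<partial>lborel)" for x
  proof (cases "g x")
    case (real r)
    have "{s. 0 < s \<and> ennreal s \<le> g x} = {0<..r}"
      using real by auto
    then show ?thesis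
      using real by simp
  next
    case top
    \<comment> \<open>Where \<open>g x\<close> is infinite the fibre is the whole half-line, which
      contains intervals of every length \<open>n\<close>.\<close>
    have "\<infinity> \<le> emeasure lborel {0::real<..}"
    proof -
      have "ennreal (real n) \<le> emeasure lborel {0::real<..}" for n
        using emeasure_mono[of "{0<..real n}" "{0::real<..}" lborel] by (simp add: subset_eq)
      then show ?thesis
        by (metis ennreal_of_nat_eq_real_of_nat ennreal_Ex_less_of_nat infinity_ennreal_def
            linorder_not_le)
    qed
    moreover have "{s. 0 < s \<and> ennreal s \<le> g x} = {0<..}"
      using top by auto
    ultimately show ?thesis
      using top by (simp add: top.extremum_unique)
  qed
  have "(\<integral>\<^sup>+ x. g x \<partial>M)
      = (\<integral>\<^sup>+ x. \<integral>\<^sup>+ s. indicator {s. 0 < s \<and> ennreal s \<le> g x} s \<partial>lborel \<partial>M)"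
    using len by presburger
  also have "\<dots> = (\<integral>\<^sup>+ s. \<integral>\<^sup>+ x. indicator {s. 0 < s \<and> ennreal s \<le> g x} s \<partial>M \<partial>lborel)"
    by (rule Fubini'[symmetric]) measurable
  also have "\<dots> = (\<integral>\<^sup>+ s. indicator {0<..} s * emeasure M {x \<in> space M. ennreal s \<le> g x} \<partial>lborel)"
  proof (rule nn_integral_cong)
    fix s :: real
    have "(\<integral>\<^sup>+ x. indicator {s. 0 < s \<and> ennreal s \<le> g x} s \<partial>M)
        = (\<integral>\<^sup>+ x. indicator {0<..} s * indicator {x \<in> space M. ennreal s \<le> g x} x \<partial>M)"
      by (intro nn_integral_cong) (auto simp: indicator_def)
    then show "(\<integral>\<^sup>+ x. indicator {s. 0 < s \<and> ennreal s \<le> g x} s \<partial>M)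
        = indicator {0<..} s * emeasure M {x \<in> space M. ennreal s \<le> g x}"
      by (simp add: nn_integral_cmult)
  qed
  finally show ?thesis .
qed

text \<open>Fatou's lemma in a form for step functions on growing finite grids: a point is
  controlled only once the grid has reached it.\<close>

lemma nn_integral_le_eventually_bounded:
  fixes h :: "'a \<Rightarrow> ennreal"
  assumes "\<And>N. G N \<in> borel_measurable M"
    and "AE t in M. \<forall>\<^sub>F N in sequentially. h t \<le> G N t"
    and "\<And>N. (\<integral>\<^sup>+ t. G N t \<partial>M) \<le> X"
  shows "(\<integral>\<^sup>+ t. h t \<partial>M) \<le> X"
proof -
  have "(\<integral>\<^sup>+ t. h t \<partial>M) \<le> (\<integral>\<^sup>+ t. liminf (\<lambda>N. G N t) \<partial>M)"
    using assms(2) by (intro nn_integral_mono_AE) (auto elim!: eventually_mono intro: Liminf_bounded)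
  also have "\<dots> \<le> liminf (\<lambda>N. \<integral>\<^sup>+ t. G N t \<partial>M)"
    by (rule nn_integral_liminf) fact
  also have "\<dots> \<le> X"
    using assms(3) by (intro Liminf_le) auto
  finally show ?thesis .
qed

text \<open>Disjointness leaves at most one nonzero summand at \<open>t\<close>. It lets estimates
  made piece by piece be added up without loss.\<close>

lemma sum_indicator_le_disjoint:
  fixes c :: "'i \<Rightarrow> ennreal"
  assumes "disjoint_family_on A F" "finite F" "\<And>k. k \<in> F \<Longrightarrow> t \<in> A k \<Longrightarrow> c k \<le> h"
  shows "(\<Sum>k\<in>F. c k * indicator (A k) t) \<le> h"
proof (cases "\<exists>k\<in>F. t \<in> A k")
  case True
  then obtain k where k: "k \<in> F" "t \<in> A k"
    by blast
  have "(\<Sum>j\<in>F. c j * indicator (A j) t) = (\<Sum>j\<in>F. if j = k then c k else 0)"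
    using assms(1) k by (intro sum.cong) (auto simp: disjoint_family_on_def indicator_def)
  then show ?thesis
    using assms k by simp
next
  case False
  then have "(\<Sum>k\<in>F. c k * indicator (A k) t) = 0"
    by (intro sum.neutral) (auto simp: indicator_def)
  then show ?thesis
    by simp
qed

text \<open>Intermediate value theorem for the measure of \<open>A \<inter> {-r..r}\<close>, which
  is Lipschitz in \<open>r\<close> and tends to the measure of \<open>A\<close>. The strict
  inequality ensures that \<open>c\<close> is passed at a finite \<open>r\<close>.\<close>

lemma exists_subset_lebesgue_measure:
  fixes A :: "real set"
  assumes A: "A \<in> sets lebesgue" and c: "0 \<le> c" "ennreal c < emeasure lebesgue A"
  shows "\<exists>B \<in> sets lebesgue. B \<subseteq> A \<and> emeasure lebesgue B = ennreal c"
proof -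
  define m where "m r = measure lebesgue (A \<inter> {-r..r})" for r
  have fin: "A \<inter> {-r..r} \<in> lmeasurable" for r :: real
    using fmeasurable_Int_fmeasurable[of "{-r..r}" lebesgue A] A by (simp add: Int_commute)
  \<comment> \<open>Passing from \<open>{-x..x}\<close> to \<open>{-y..y}\<close> adds two intervals
    of length \<open>y - x\<close>, hence the constant 2.\<close>
  have lip: "m y \<le> m x + 2 * (y - x)" if "0 \<le> x" "x \<le> y" for x y
  proof -
    have "m y \<le> measure lebesgue ((A \<inter> {-x..x}) \<union> ({-y..-x} \<union> {x..y}))"
      unfolding m_def using fin A by (intro measure_mono_fmeasurable fmeasurable.Un) (auto intro: fmeasurableD)
    also have "\<dots> \<le> m x + measure lebesgue ({-y..-x} \<union> {x..y})"
      unfolding m_def using fin by (intro measure_Un_le) (auto intro: fmeasurableD)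
    also have "measure lebesgue ({-y..-x} \<union> {x..y}) \<le> measure lebesgue {-y..-x} + measure lebesgue {x..y}"
      by (intro measure_Un_le) auto
    also have "\<dots> = 2 * (y - x)"
      using that by simp
    finally show ?thesis by simp
  qed
  have mono: "m x \<le> m y" if "x \<le> y" for x y
    unfolding m_def using that fin by (intro measure_mono_fmeasurable) (auto intro: fmeasurableD)
  have cont: "continuous_on {0..} m"
  proof (rule lipschitz_on_continuous_on[of 2], rule lipschitz_onI)
    fix x y :: real assume "x \<in> {0..}" "y \<in> {0..}"
    then show "dist (m x) (m y) \<le> 2 * dist x y"
      using lip[of x y] lip[of y x] mono[of x y] mono[of y x] by (cases "x \<le> y") (auto simp: dist_real_def)
  qed simp
  have "(\<lambda>n. emeasure lebesgue (A \<inter> {-real n..real n})) \<longlonglongrightarrow> emeasure lebesgue (\<Union>n. A \<inter> {-real n..real n})"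
    using A by (intro Lim_emeasure_incseq) (auto simp: incseq_def)
  moreover have "(\<Union>n. A \<inter> {-real n..real n}) = A"
  proof -
    have "\<exists>n. x \<in> {-real n..real n}" for x
    proof -
      obtain n where "\<bar>x\<bar> \<le> real n"
        using real_arch_simple by blast
      then have "x \<in> {-real n..real n}"
        by auto
      then show ?thesis by blast
    qed
    then show ?thesis by blast
  qed
  ultimately have "\<forall>\<^sub>F n in sequentially. ennreal c < emeasure lebesgue (A \<inter> {-real n..real n})"
    using c(2) by (auto intro: order_tendstoD)
  then obtain n where "ennreal c < emeasure lebesgue (A \<inter> {-real n..real n})"
    by (auto simp: eventually_sequentially)
  then have "c < m (real n)"
    using fin[of "real n"] c(1) by (simp add: m_def emeasure_eq_measure2 ennreal_less_iff)
  moreover have "m 0 = 0"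
    using negligible_imp_measure0[OF negligible_subset[OF negligible_sing[of "0::real"]], of "A \<inter> {-0..0}"]
    by (simp add: m_def subset_iff)
  ultimately obtain r where "m r = c"
    using IVT'[of m 0 c "real n"] c(1) continuous_on_subset[OF cont, of "{0..real n}"] by auto
  then show ?thesis
    using fin[of r] by (intro bexI[of _ "A \<inter> {-r..r}"])
      (auto simp: m_def emeasure_eq_measure2 intro: fmeasurableD)
qed

lemma nn_integral_lebesgue_on_subset:
  assumes "E \<subseteq> I" "E \<in> sets lebesgue" "I \<in> sets lebesgue"
  shows "(\<integral>\<^sup>+ t. h t \<partial>lebesgue_on E) = (\<integral>\<^sup>+ t. h t * indicator E t \<partial>lebesgue_on I)"
proof -
  have "indicator E t * indicator I t = (indicator E t :: ennreal)" for t
    using assms(1) by (auto simp: indicator_def)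
  then show ?thesis
    using assms by (simp add: nn_integral_restrict_space mult.assoc)
qed

text \<open>The cells with \<open>k < 2 * N\<close> tile the interval from \<open>1 / q ^ N\<close>
  to \<open>q ^ N\<close>, which exhausts the positive half-line. Dividing by \<open>q ^ N\<close>
  stands in for negative exponents.\<close>

lemma eventually_geometric_grid:
  fixes q t :: real
  assumes q: "1 < q" and t: "0 < t"
  shows "\<forall>\<^sub>F N in sequentially. \<exists>k<2 * N. q ^ k / q ^ N \<le> t \<and> t < q ^ Suc k / q ^ N"
proof -
  obtain n where n: "max t (1 / t) < q ^ n"
    using real_arch_pow[OF q] by blast
  show ?thesis
  proof (intro eventually_sequentiallyI[of "Suc n"])
    fix N assume N: "Suc n \<le> N"
    then have "q ^ n \<le> q ^ N"
      using q by (intro power_increasing) auto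
    then have tN: "t < q ^ N" "1 / t < q ^ N"
      using n by auto
    \<comment> \<open>The first cell whose right end exceeds \<open>t\<close>. By minimality its
      left end is at most \<open>t\<close>; for \<open>k = 0\<close> this is
      \<open>1 / t < q ^ N\<close>.\<close>
    define k where "k = (LEAST k. t < q ^ Suc k / q ^ N)"
    have "t < q ^ Suc (2 * N - 1) / q ^ N"
    proof -
      have "Suc (2 * N - 1) = N + N"
        using N by simp
      then have "q ^ Suc (2 * N - 1) / q ^ N = q ^ N"
        using q by (simp only: power_add) simp
      then show ?thesis
        using tN by simp
    qed
    then have k: "t < q ^ Suc k / q ^ N" "k \<le> 2 * N - 1"
      unfolding k_def by (rule LeastI, rule Least_le)
    have "q ^ k / q ^ N \<le> t"
    proof (cases k)
      case 0
      then show ?thesis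
        using tN t q by (simp add: field_simps)
    next
      case (Suc j)
      then show ?thesis
        using not_less_Least[of j "\<lambda>k. t < q ^ Suc k / q ^ N"] k_def by (simp add: not_less)
    qed
    then show "\<exists>k<2 * N. q ^ k / q ^ N \<le> t \<and> t < q ^ Suc k / q ^ N"
      using k N by (intro exI[of _ k]) auto
  qed
qed

subsection \<open>Orlicz functions\<close>

lemma orlicz_mono:
  assumes "orlicz_function \<phi>" "0 \<le> x" "x \<le> y"
  shows "\<phi> x \<le> \<phi> y"
proof (cases "x = y")
  case False
  then show ?thesis
    using assms strict_mono_onD[of "{0..}" \<phi> x y] by (auto simp: orlicz_function_def)
qed simp

lemma orlicz_nonneg:
  assumes "orlicz_function \<phi>" "0 \<le> x"
  shows "0 \<le> \<phi> x"
  using orlicz_mono[OF assms(1), of 0 x] assms by (simp add: orlicz_function_def)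

lemma orlicz_pos:
  assumes "orlicz_function \<phi>" "0 < x"
  shows "0 < \<phi> x"
  using assms strict_mono_onD[of "{0..}" \<phi> 0 x] by (auto simp: orlicz_function_def)

lemma orlicz_scale:
  assumes "orlicz_function \<phi>" "0 \<le> c" "c \<le> 1" "0 \<le> x"
  shows "\<phi> (c * x) \<le> c * \<phi> x"
  using assms convex_onD[of "{0..}" \<phi> c 0 x] by (simp add: orlicz_function_def)

text \<open>Convexity and \<open>\<phi> 0 = 0\<close> make \<open>\<phi> r / r\<close> increasing in
  \<open>r\<close>; put \<open>r = x / y\<close>. So lowering the weight bounds an integrand from
  above, and raising it bounds it from below.\<close>

lemma orlicz_perspective_antimono:
  assumes "orlicz_function \<phi>" "0 \<le> x" "0 < y" "y \<le> z"
  shows "\<phi> (x / z) * z \<le> \<phi> (x / y) * y"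
proof -
  have "\<phi> (x / z) \<le> (y / z) * \<phi> (x / y)"
    using orlicz_scale[OF assms(1), of "y / z" "x / y"] assms by simp
  then show ?thesis
    using assms by (simp add: field_simps)
qed

lemma orlicz_ext_ennreal:
  "0 \<le> x \<Longrightarrow> orlicz_ext \<phi> (ennreal x) = ennreal (\<phi> x)"
  by (simp add: orlicz_ext_def)

lemma orlicz_ext_mono:
  assumes "orlicz_function \<phi>" "x \<le> y"
  shows "orlicz_ext \<phi> x \<le> orlicz_ext \<phi> y"
proof (cases "y = \<infinity>")
  case False
  then have "x \<noteq> \<infinity>" "enn2real x \<le> enn2real y"
    using assms(2) by (auto simp: top_unique less_top intro: enn2real_mono)
  then show ?thesis
    using False orlicz_mono[OF assms(1), of "enn2real x" "enn2real y"]
    by (simp add: orlicz_ext_def ennreal_leI)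
qed (simp add: orlicz_ext_def)

lemma P_integrand_pos: "0 < y \<Longrightarrow> P_integrand \<phi> x y = ennreal (\<phi> (\<bar>x\<bar> / y) * y)"
  by (simp add: P_integrand_def)

lemma P_integrand_mono:
  assumes \<phi>: "orlicz_function \<phi>" and "\<bar>x\<bar> \<le> \<bar>x'\<bar>" "0 < y'" "y' \<le> y"
  shows "P_integrand \<phi> x y \<le> P_integrand \<phi> x' y'"
proof -
  have "\<phi> (\<bar>x\<bar> / y) * y \<le> \<phi> (\<bar>x\<bar> / y') * y'"
    using assms by (intro orlicz_perspective_antimono) auto
  also have "\<dots> \<le> \<phi> (\<bar>x'\<bar> / y') * y'"
    using assms by (intro mult_right_mono orlicz_mono[OF \<phi>] divide_right_mono) auto
  finally show ?thesis
    using assms by (auto simp: P_integrand_pos intro: ennreal_leI)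
qed

lemma P_integrand_scale:
  assumes \<phi>: "orlicz_function \<phi>" and "1 \<le> c" "0 \<le> y"
  shows "P_integrand \<phi> (x / c) y \<le> ennreal (1 / c) * P_integrand \<phi> x y"
proof (cases "y = 0")
  case True
  then show ?thesis
    using assms by (auto simp: P_integrand_def ennreal_mult_top)
next
  case False
  have "\<phi> (\<bar>x / c\<bar> / y) \<le> (1 / c) * \<phi> (\<bar>x\<bar> / y)"
    using orlicz_scale[OF \<phi>, of "1 / c" "\<bar>x\<bar> / y"] assms by (simp add: mult.commute)
  then have "\<phi> (\<bar>x / c\<bar> / y) * y \<le> (1 / c) * (\<phi> (\<bar>x\<bar> / y) * y)"
    using mult_right_mono[of _ _ y] assms by fastforce
  then show ?thesis
    using False assms by (simp add: P_integrand_def ennreal_mult'[symmetric] ennreal_leI)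
qed

text \<open>Replacing the supporting line of \<open>\<phi>\<close> at \<open>z\<close> by the line through \<open>(z, 0)\<close> of slope \<open>\<phi> z / z\<close> costs
  only a constant factor below and avoids subgradients.\<close>

lemma P_integrand_lower_bound:
  assumes \<phi>: "orlicz_function \<phi>" and "0 < z" "0 \<le> y"
  shows "ennreal (\<phi> z / z * \<bar>x\<bar>) \<le> P_integrand \<phi> x y + ennreal (\<phi> z * y)"
proof (cases "y = 0")
  case True
  then show ?thesis
    by (auto simp: P_integrand_def)
next
  case False
  then have y: "0 < y"
    using assms by simp
  define q where "q = \<bar>x\<bar> / y"
  have q: "0 \<le> q" "\<bar>x\<bar> = q * y"
    using y by (auto simp: q_def)
  have "\<phi> z / z * q \<le> \<phi> q + \<phi> z"
  proof (cases "z \<le> q")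
    case True
    then have "\<phi> z \<le> z / q * \<phi> q"
      using orlicz_scale[OF \<phi>, of "z / q" q] assms(2) by simp
    then have "\<phi> z / z * q \<le> \<phi> q"
      using True assms(2) by (simp add: field_simps)
    then show ?thesis
      using orlicz_pos[OF \<phi> assms(2)] by simp
  next
    case False
    then have "\<phi> z / z * q \<le> \<phi> z / z * z"
      using assms(2) orlicz_pos[OF \<phi> assms(2)] by (intro mult_left_mono) auto
    then show ?thesis
      using assms(2) orlicz_nonneg[OF \<phi> q(1)] by simp
  qed
  then have "\<phi> z / z * q * y \<le> (\<phi> q + \<phi> z) * y"
    using y by (intro mult_right_mono) auto
  then have "\<phi> z / z * \<bar>x\<bar> \<le> \<phi> q * y + \<phi> z * y"
    using q by (simp add: algebra_simps)
  then show ?thesis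
    using y q orlicz_nonneg[OF \<phi> q(1)] orlicz_pos[OF \<phi> assms(2)]
    by (simp add: P_integrand_pos q_def[symmetric] ennreal_plus[symmetric] ennreal_leI
        del: ennreal_plus)
qed

lemma borel_measurable_P_integrand:
  assumes \<phi>: "orlicz_function \<phi>"
    and [measurable]: "f \<in> borel_measurable M" "v \<in> borel_measurable M"
    and v: "\<And>t. t \<in> space M \<Longrightarrow> 0 \<le> v t"
  shows "(\<lambda>t. P_integrand \<phi> (f t) (v t)) \<in> borel_measurable M"
proof -
  \<comment> \<open>\<open>\<phi>\<close> is monotone only on the nonnegative half-line;
    \<open>max 0\<close> extends it monotonically to all reals without changing it at the quotients
    that occur.\<close>
  have [measurable]: "(\<lambda>x. \<phi> (max 0 x)) \<in> borel_measurable borel"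
    by (intro borel_measurable_mono monoI orlicz_mono[OF \<phi>]) auto
  have "(\<lambda>t. if v t = 0 then (if f t = 0 then 0 else \<infinity>)
          else ennreal ((\<lambda>x. \<phi> (max 0 x)) (\<bar>f t\<bar> / v t) * v t)) \<in> borel_measurable M"
    by measurable
  then show ?thesis
    by (rule measurable_cong[THEN iffD1, rotated]) (use v in \<open>auto simp: P_integrand_def\<close>)
qed

subsection \<open>Level sets and rearrangements\<close>

lemma L0_level_sets:
  assumes "f \<in> L0 I" "I \<in> sets lebesgue" "S \<in> sets borel"
  shows "{t \<in> I. f t \<in> S} \<in> sets lebesgue"
proof -
  have "f -` S \<inter> space (lebesgue_on I) \<in> sets (lebesgue_on I)"
    using assms by (intro measurable_sets[of f _ borel]) (auto simp: L0_def)
  moreover have "f -` S \<inter> space (lebesgue_on I) = {t \<in> I. f t \<in> S}"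
    by auto
  ultimately show ?thesis
    using assms(2) by (auto simp: sets_restrict_space)
qed

lemma L0_abs_level_sets:
  assumes "f \<in> L0 I" "I \<in> sets lebesgue" "S \<in> sets borel"
  shows "{t \<in> I. \<bar>f t\<bar> \<in> S} \<in> sets lebesgue"
proof -
  have "(\<lambda>t. \<bar>f t\<bar>) \<in> L0 I"
    using assms(1) by (simp add: L0_def)
  then show ?thesis
    using L0_level_sets assms by blast
qed

lemma rearrangement_antimono: "antimono (rearrangement I f)"
  unfolding rearrangement_def by (intro antimonoI INF_superset_mono) (auto intro: order_trans ennreal_leI)

lemma rearrangement_mono_distribution:
  assumes "\<And>s. 0 \<le> s \<Longrightarrow> distribution_function I f s \<le> distribution_function I g s"
  shows "rearrangement I f t \<le> rearrangement I g t"
  unfolding rearrangement_def using assms by (intro INF_superset_mono) (auto intro: order_trans)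

text \<open>A level \<open>s' < s\<close> is not admissible in the infimum: the set where
  \<open>\<bar>f\<bar> > s'\<close> contains the given one, so its measure exceeds
  \<open>t\<close>.\<close>

lemma le_rearrangement:
  assumes "f \<in> L0 I" "I \<in> sets lebesgue"
    and "ennreal t < emeasure lebesgue {r \<in> I. s \<le> \<bar>f r\<bar>}"
  shows "ennreal s \<le> rearrangement I f t"
  unfolding rearrangement_def
proof (rule INF_greatest)
  fix s' assume s': "s' \<in> {s. 0 \<le> s \<and> distribution_function I f s \<le> ennreal t}"
  have "s \<le> s'"
  proof (rule ccontr)
    assume "\<not> s \<le> s'"
    then have "emeasure lebesgue {r \<in> I. s \<le> \<bar>f r\<bar>} \<le> distribution_function I f s'"
      unfolding distribution_function_def using L0_abs_level_sets[OF assms(1,2), of "{s'<..}"]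
      by (intro emeasure_mono) auto
    then show False
      using s' assms(3) by auto
  qed
  then show "ennreal s \<le> ennreal s'"
    by (rule ennreal_leI)
qed

lemma less_rearrangementD:
  assumes "ennreal s < rearrangement I f t" "0 \<le> s"
  shows "ennreal t < distribution_function I f s"
proof (rule ccontr)
  assume "\<not> ?thesis"
  then have "rearrangement I f t \<le> ennreal s"
    unfolding rearrangement_def using assms(2) by (intro INF_lower) auto
  then show False
    using assms(1) by simp
qed

text \<open>\<open>S\<close> may be uncountable, but level sets are nested, so only
  \<open>Inf S\<close> matters: the union is a single closed level set if the infimum is attained,
  and otherwise a countable increasing union to which continuity from below applies.\<close>

lemma emeasure_upper_level_set_le:
  assumes f: "f \<in> L0 I" "I \<in> sets lebesgue"
    and S: "\<And>s. s \<in> S \<Longrightarrow> 0 \<le> s" "\<And>s. s \<in> S \<Longrightarrow> emeasure lebesgue {t \<in> I. s \<le> \<bar>f t\<bar>} \<le> D"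
  shows "{t \<in> I. \<exists>s\<in>S. s \<le> \<bar>f t\<bar>} \<in> sets lebesgue \<and> emeasure lebesgue {t \<in> I. \<exists>s\<in>S. s \<le> \<bar>f t\<bar>} \<le> D"
proof (cases "S = {} \<or> Inf S \<in> S")
  case True
  have bdd: "bdd_below S"
    using S(1) by (auto simp: bdd_below_def)
  from True show ?thesis
  proof
    assume "Inf S \<in> S"
    then have "{t \<in> I. \<exists>s\<in>S. s \<le> \<bar>f t\<bar>} = {t \<in> I. Inf S \<le> \<bar>f t\<bar>}"
      using cInf_lower[OF _ bdd] by (auto intro: order_trans)
    then show ?thesis
      using S(2)[OF \<open>Inf S \<in> S\<close>] L0_abs_level_sets[OF f, of "{Inf S..}"] by simp
  qed simp
next
  case False
  have bdd: "bdd_below S"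
    using S(1) by (auto simp: bdd_below_def)
  define A where "A n = {t \<in> I. Inf S + 1 / real (Suc n) \<le> \<bar>f t\<bar>}" for n
  have A: "A n \<in> sets lebesgue" for n
    unfolding A_def using L0_abs_level_sets[OF f, of "{Inf S + 1 / real (Suc n)..}"] by simp
  have inc: "incseq A"
    unfolding A_def incseq_def
  proof (safe)
    fix m n :: nat and t assume "m \<le> n" and t: "Inf S + 1 / real (Suc m) \<le> \<bar>f t\<bar>"
    then have "1 / real (Suc n) \<le> 1 / real (Suc m)"
      by (simp add: frac_le)
    then show "Inf S + 1 / real (Suc n) \<le> \<bar>f t\<bar>"
      using t by linarith
  qed
  have AD: "emeasure lebesgue (A n) \<le> D" for n
  proof -
    obtain s where s: "s \<in> S" "s < Inf S + 1 / real (Suc n)"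
      using cInf_lessD[of S "Inf S + 1 / real (Suc n)"] False by auto
    have "emeasure lebesgue (A n) \<le> emeasure lebesgue {t \<in> I. s \<le> \<bar>f t\<bar>}"
      unfolding A_def using s L0_abs_level_sets[OF f, of "{s..}"] by (intro emeasure_mono) auto
    then show ?thesis
      using S(2)[OF s(1)] by simp
  qed
  have eq: "{t \<in> I. \<exists>s\<in>S. s \<le> \<bar>f t\<bar>} = (\<Union>n. A n)"
  proof safe
    fix t s assume t: "t \<in> I" "s \<in> S" "s \<le> \<bar>f t\<bar>"
    then have "Inf S < s"
      using cInf_lower[OF t(2) bdd] False by (metis order_le_less)
    then obtain n where "inverse (real (Suc n)) < s - Inf S"
      using reals_Archimedean[of "s - Inf S"] by auto
    then have "t \<in> A n"
      using t by (simp add: A_def inverse_eq_divide)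
    then show "t \<in> (\<Union>n. A n)"
      by blast
  next
    fix t n assume t: "t \<in> A n"
    obtain s where "s \<in> S" "s < Inf S + 1 / real (Suc n)"
      using cInf_lessD[of S "Inf S + 1 / real (Suc n)"] False by auto
    then show "t \<in> I" "\<exists>s\<in>S. s \<le> \<bar>f t\<bar>"
      using t by (auto simp: A_def intro!: bexI[of _ s])
  qed
  have "emeasure lebesgue (\<Union>n. A n) = (SUP n. emeasure lebesgue (A n))"
    using A inc by (intro SUP_emeasure_incseq[symmetric]) auto
  also have "\<dots> \<le> D"
    using AD by (intro SUP_least)
  finally show ?thesis
    unfolding eq using A by auto
qed

text \<open>The Hardy-Littlewood inequality for a set. By the layer cake formula it suffices to
  compare level sets, one height \<open>s\<close> at a time.\<close>

lemma nn_integral_le_rearrangement: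
  assumes v: "v \<in> L0 I" "I \<in> sets lebesgue"
    and E: "E \<subseteq> I" "E \<in> sets lebesgue" "emeasure lebesgue E \<le> ennreal x" "0 \<le> x"
  shows "(\<integral>\<^sup>+ t. ennreal \<bar>v t\<bar> \<partial>lebesgue_on E) \<le> (\<integral>\<^sup>+ t. rearrangement I v t \<partial>lebesgue_on {0<..<x})"
proof -
  interpret E: sigma_finite_measure "lebesgue_on E"
    by (rule sigma_finite_lebesgue_on) fact
  interpret X: sigma_finite_measure "lebesgue_on {0<..<x}"
    by (rule sigma_finite_lebesgue_on) simp
  have vE: "v \<in> borel_measurable (lebesgue_on E)"
    by (rule measurable_restrict_mono[OF _ E(1)]) (use v(1) in \<open>simp add: L0_def\<close>)
  have rb: "rearrangement I v \<in> borel_measurable borel"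
    by (rule borel_measurable_antimono[OF rearrangement_antimono])
  then have r: "rearrangement I v \<in> borel_measurable (lebesgue_on {0<..<x})"
    by (intro measurable_restrict_space1 measurable_completion) simp
  have ineq: "emeasure (lebesgue_on E) {t \<in> space (lebesgue_on E). ennreal s \<le> ennreal \<bar>v t\<bar>}
      \<le> emeasure (lebesgue_on {0<..<x}) {t \<in> space (lebesgue_on {0<..<x}). ennreal s \<le> rearrangement I v t}"
    if "0 < s" for s
  proof -
    define m where "m = emeasure lebesgue {r \<in> I. s \<le> \<bar>v r\<bar>}"
    \<comment> \<open>The part of \<open>E\<close> above height \<open>s\<close> has measure at most
      \<open>y\<close>, and the rearrangement is at least \<open>s\<close> on
      \<open>{0<..<y}\<close>. The minimum with \<open>x\<close> is finite even if \<open>m\<close>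
      is not, so \<open>y\<close> is a genuine real.\<close>
    define y where "y = enn2real (min (ennreal x) m)"
    have "min (ennreal x) m < \<infinity>"
      by (simp add: min_less_iff_disj)
    then have y: "ennreal y = min (ennreal x) m"
      unfolding y_def by simp
    have y0: "0 \<le> y" "y \<le> x"
      using y E(4) by (auto simp: y_def intro: enn2real_leI)
    have R: "{t \<in> {0<..<x}. ennreal s \<le> rearrangement I v t} \<in> sets lebesgue"
    proof -
      have "{t \<in> space borel. ennreal s \<le> rearrangement I v t} \<in> sets borel"
        using rb by measurable
      moreover have "{t \<in> {0<..<x}. ennreal s \<le> rearrangement I v t}
          = {0<..<x} \<inter> {t \<in> space borel. ennreal s \<le> rearrangement I v t}"
        by auto
      ultimately show ?thesis
        by (intro sets_lebesgue_borel) auto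
    qed
    have Vm: "{t \<in> E. s \<le> \<bar>v t\<bar>} \<in> sets lebesgue" "{t \<in> I. s \<le> \<bar>v t\<bar>} \<in> sets lebesgue"
    proof -
      show I': "{t \<in> I. s \<le> \<bar>v t\<bar>} \<in> sets lebesgue"
        using L0_abs_level_sets[OF v, of "{s..}"] by simp
      have "{t \<in> E. s \<le> \<bar>v t\<bar>} = E \<inter> {t \<in> I. s \<le> \<bar>v t\<bar>}"
        using E(1) by auto
      then show "{t \<in> E. s \<le> \<bar>v t\<bar>} \<in> sets lebesgue"
        using I' E(2) by simp
    qed
    have "emeasure lebesgue {t \<in> E. s \<le> \<bar>v t\<bar>} \<le> min (ennreal x) m"
      unfolding m_def
    proof (rule min.boundedI)
      show "emeasure lebesgue {t \<in> E. s \<le> \<bar>v t\<bar>} \<le> ennreal x"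
        using emeasure_mono[of "{t \<in> E. s \<le> \<bar>v t\<bar>}" E lebesgue] E by (auto intro: order_trans)
      show "emeasure lebesgue {t \<in> E. s \<le> \<bar>v t\<bar>} \<le> emeasure lebesgue {r \<in> I. s \<le> \<bar>v r\<bar>}"
        using Vm E(1) by (intro emeasure_mono) auto
    qed
    also have "\<dots> = emeasure lebesgue {0<..<y}"
      using y y0 by simp
    also have "\<dots> \<le> emeasure lebesgue {t \<in> {0<..<x}. ennreal s \<le> rearrangement I v t}"
    proof (intro emeasure_mono R subsetI)
      fix t assume t: "t \<in> {0<..<y}"
      then have "ennreal t < ennreal y"
        by (simp add: ennreal_less_iff)
      then have "ennreal t < m"
        using y by simp
      then show "t \<in> {t \<in> {0<..<x}. ennreal s \<le> rearrangement I v t}"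
        using t y0 le_rearrangement[OF v, of t s] by (auto simp: m_def)
    qed
    finally have "emeasure lebesgue {t \<in> E. s \<le> \<bar>v t\<bar>}
        \<le> emeasure lebesgue {t \<in> {0<..<x}. ennreal s \<le> rearrangement I v t}" .
    then show ?thesis
      using that E(2) by (subst (1 2) emeasure_restrict_space) (auto simp: ennreal_le_iff)
  qed
  have "(\<integral>\<^sup>+ t. ennreal \<bar>v t\<bar> \<partial>lebesgue_on E)
      = (\<integral>\<^sup>+ s. indicator {0<..} s * emeasure (lebesgue_on E)
            {t \<in> space (lebesgue_on E). ennreal s \<le> ennreal \<bar>v t\<bar>} \<partial>lborel)"
    using vE by (intro E.nn_integral_layer_cake) measurable
  also have "\<dots> \<le> (\<integral>\<^sup>+ s. indicator {0<..} s * emeasure (lebesgue_on {0<..<x})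
            {t \<in> space (lebesgue_on {0<..<x}). ennreal s \<le> rearrangement I v t} \<partial>lborel)"
    using ineq by (intro nn_integral_mono) (simp split: split_indicator del: space_restrict_space ennreal_le_iff)
  also have "\<dots> = (\<integral>\<^sup>+ t. rearrangement I v t \<partial>lebesgue_on {0<..<x})"
    using r by (intro X.nn_integral_layer_cake[symmetric])
  finally show ?thesis .
qed

subsection \<open>Luxemburg functionals\<close>

text \<open>Convexity acts on the integrand for each fixed competitor \<open>v\<close>. The use is
  to bring a finite modular below 1.\<close>

lemma P_modular_scale:
  assumes \<phi>: "orlicz_function \<phi>" and f: "f \<in> L0 I" and c: "1 \<le> c"
  shows "P_modular I \<phi> w (\<lambda>t. f t / c) \<le> ennreal (1 / c) * P_modular I \<phi> w f"
proof -
  define V where "V = {v \<in> L0 I. (\<forall>t\<in>I. 0 \<le> v t) \<and> submajorized I v w}"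
  have P_eq: "P_modular I \<phi> w g = (INF v\<in>V. \<integral>\<^sup>+ t. P_integrand \<phi> (g t) (v t) \<partial>lebesgue_on I)" for g
    by (simp add: P_modular_def V_def)
  have le: "P_modular I \<phi> w (\<lambda>t. f t / c)
      \<le> ennreal (1 / c) * (\<integral>\<^sup>+ t. P_integrand \<phi> (f t) (v t) \<partial>lebesgue_on I)" if v: "v \<in> V" for v
  proof -
    have "P_modular I \<phi> w (\<lambda>t. f t / c) \<le> (\<integral>\<^sup>+ t. P_integrand \<phi> (f t / c) (v t) \<partial>lebesgue_on I)"
      unfolding P_eq by (rule INF_lower[OF v])
    also have "\<dots> \<le> (\<integral>\<^sup>+ t. ennreal (1 / c) * P_integrand \<phi> (f t) (v t) \<partial>lebesgue_on I)"
      using v c by (intro nn_integral_mono P_integrand_scale[OF \<phi>]) (auto simp: V_def)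
    also have "\<dots> = ennreal (1 / c) * (\<integral>\<^sup>+ t. P_integrand \<phi> (f t) (v t) \<partial>lebesgue_on I)"
      using v f by (intro nn_integral_cmult borel_measurable_P_integrand[OF \<phi>]) (auto simp: V_def L0_def)
    finally show ?thesis .
  qed
  \<comment> \<open>With the factor \<open>c\<close> on the left, the infimum over \<open>v\<close>
    can be taken on the right alone.\<close>
  have "ennreal c * P_modular I \<phi> w (\<lambda>t. f t / c) \<le> P_modular I \<phi> w f"
    unfolding P_eq[of f]
  proof (rule INF_greatest)
    fix v assume v: "v \<in> V"
    have "ennreal c * P_modular I \<phi> w (\<lambda>t. f t / c)
        \<le> ennreal c * (ennreal (1 / c) * (\<integral>\<^sup>+ t. P_integrand \<phi> (f t) (v t) \<partial>lebesgue_on I))"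
      by (intro mult_left_mono le v) simp
    also have "\<dots> = (\<integral>\<^sup>+ t. P_integrand \<phi> (f t) (v t) \<partial>lebesgue_on I)"
      using c by (simp add: mult.assoc[symmetric] ennreal_mult[symmetric])
    finally show "ennreal c * P_modular I \<phi> w (\<lambda>t. f t / c)
        \<le> (\<integral>\<^sup>+ t. P_integrand \<phi> (f t) (v t) \<partial>lebesgue_on I)" .
  qed
  then have "ennreal (1 / c) * (ennreal c * P_modular I \<phi> w (\<lambda>t. f t / c))
      \<le> ennreal (1 / c) * P_modular I \<phi> w f"
    by (rule mult_left_mono) simp
  then show ?thesis
    using c by (simp add: mult.assoc[symmetric] ennreal_mult[symmetric])
qed

text \<open>If \<open>e\<close> is admissible for \<open>B\<close>, then \<open>K * e\<close> is
  admissible for \<open>A\<close>. Thus comparing modulars up to a dilation suffices for comparing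
  norms.\<close>

lemma luxemburg_norm_le:
  fixes A B :: "('a \<Rightarrow> real) \<Rightarrow> ennreal"
  assumes "0 < K" and "\<And>e. 0 < e \<Longrightarrow> A (\<lambda>t. f t / (K * e)) \<le> B (\<lambda>t. f t / e)"
  shows "(INF e \<in> {e. 0 < e \<and> A (\<lambda>t. f t / e) \<le> 1}. ennreal e)
      \<le> ennreal K * (INF e \<in> {e. 0 < e \<and> B (\<lambda>t. f t / e) \<le> 1}. ennreal e)"
    (is "?a \<le> _ * ?b")
proof -
  have "ennreal (1 / K) * ?a \<le> ?b"
  proof (rule INF_greatest)
    fix e assume e: "e \<in> {e. 0 < e \<and> B (\<lambda>t. f t / e) \<le> 1}"
    then have "?a \<le> ennreal (K * e)"
      using assms by (intro INF_lower) (auto intro: order_trans)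
    then have "ennreal (1 / K) * ?a \<le> ennreal (1 / K) * ennreal (K * e)"
      by (rule mult_left_mono) simp
    also have "\<dots> = ennreal e"
      using assms(1) e by (simp add: ennreal_mult[symmetric])
    finally show "ennreal (1 / K) * ?a \<le> ennreal e" .
  qed
  then have "ennreal K * (ennreal (1 / K) * ?a) \<le> ennreal K * ?b"
    by (rule mult_left_mono) simp
  then show ?thesis
    using assms(1) by (simp add: mult.assoc[symmetric] ennreal_mult[symmetric])
qed

subsection \<open>Regular weights\<close>

text \<open>A regularity constant may be enlarged, so \<open>1 \<le> C\<close> is only a
  normalisation. It makes factors such as \<open>4 * C\<close> at least 1 and lets
  \<open>C\<^sup>2\<close> absorb \<open>C\<close>.\<close>

locale regular_weight_on_interval =
  fixes I :: "real set" and a :: ereal and w :: "real \<Rightarrow> real" and C :: real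
  assumes I_eq: "I = einterval 0 a"
    and weight: "weight_function I w"
    and w_pos: "\<And>t. t \<in> I \<Longrightarrow> 0 < w t"
    and C_ge_1: "1 \<le> C"
    and regular: "\<And>u. u \<in> I \<Longrightarrow> primitive w u \<le> ennreal (C * u * w u)"
begin

lemma mem_I_iff: "t \<in> I \<longleftrightarrow> 0 < t \<and> ereal t < a"
  by (auto simp: I_eq einterval_def zero_ereal_def)

lemma I_pos: "t \<in> I \<Longrightarrow> 0 < t"
  by (simp add: mem_I_iff)

lemma I_down: "t \<in> I \<Longrightarrow> 0 < s \<Longrightarrow> s \<le> t \<Longrightarrow> s \<in> I"
  unfolding mem_I_iff by (meson ereal_less_eq(3) le_less_trans)

lemma I_sets: "I \<in> sets lebesgue"
  unfolding I_eq by (rule sets_lebesgue_borel) simp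

lemma w_antimono: "s \<in> I \<Longrightarrow> t \<in> I \<Longrightarrow> s \<le> t \<Longrightarrow> w t \<le> w s"
  using weight by (auto simp: weight_function_def monotone_on_def)

text \<open>Strict because \<open>I\<close> is open on the right and extends beyond
  \<open>x\<close>. Strictness is what allows a subset of measure exactly \<open>x\<close> to be cut
  out.\<close>

lemma less_emeasure_I:
  assumes "x \<in> I"
  shows "ennreal x < emeasure lebesgue I"
proof -
  obtain y where y: "x < y" "y \<in> I"
    using ereal_dense2[of "ereal x" a] assms I_pos by (auto simp: mem_I_iff)
  have "ennreal x < ennreal y"
    using y I_pos[OF assms] by (simp add: ennreal_less_iff)
  also have "\<dots> = emeasure lebesgue {0<..<y}"
    using I_pos[OF y(2)] by simp
  also have "\<dots> \<le> emeasure lebesgue I"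
    using y I_sets by (intro emeasure_mono) (auto intro: I_down)
  finally show ?thesis .
qed

text \<open>\<open>w\<close> exceeds \<open>w t\<close> only to the left of \<open>t\<close>. At a
  jump \<open>w\<close> may be larger than its rearrangement, hence an inequality.\<close>

lemma rearrangement_weight_le:
  assumes t: "t \<in> I"
  shows "rearrangement I w t \<le> ennreal (w t)"
proof -
  have "{r \<in> I. w t < \<bar>w r\<bar>} \<subseteq> {0<..<t}"
  proof
    fix r assume r: "r \<in> {r \<in> I. w t < \<bar>w r\<bar>}"
    then have "w t < w r"
      using w_pos[of r] by auto
    then have "r < t"
      using w_antimono[of t r] t r by force
    then show "r \<in> {0<..<t}"
      using r I_pos by auto
  qed
  then have "distribution_function I w (w t) \<le> emeasure lebesgue {0<..<t}"
    unfolding distribution_function_def by (intro emeasure_mono) auto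
  also have "\<dots> = ennreal t"
    using I_pos[OF t] by simp
  finally show ?thesis
    unfolding rearrangement_def using w_pos[OF t] by (intro INF_lower) auto
qed

lemma le_primitive:
  assumes "u \<in> I" "y \<in> I" "u \<le> y"
  shows "ennreal (u * w u) \<le> primitive w y"
proof -
  have sub: "{0<..<u} \<subseteq> {0<..<y}"
    using assms by auto
  have "ennreal (u * w u) = (\<integral>\<^sup>+ s. ennreal (w u) \<partial>lebesgue_on {0<..<u})"
    using I_pos[OF assms(1)] w_pos[OF assms(1)]
    by (simp add: emeasure_restrict_space ennreal_mult mult.commute)
  also have "\<dots> = (\<integral>\<^sup>+ s. ennreal (w u) * indicator {0<..<u} s \<partial>lebesgue_on {0<..<y})"
    by (intro nn_integral_lebesgue_on_subset[OF sub]) auto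
  also have "\<dots> \<le> (\<integral>\<^sup>+ s. ennreal (w s) \<partial>lebesgue_on {0<..<y})"
    using w_antimono[OF I_down[OF assms(1)] assms(1)]
    by (intro nn_integral_mono) (auto simp: indicator_def intro!: ennreal_leI)
  finally show ?thesis
    by (simp add: primitive_def)
qed

text \<open>For \<open>u \<le> y\<close> the chain is
  \<open>u * w u \<le> W y \<le> C * y * w y \<le> 4 * C * u * w y\<close>, with \<open>W\<close>
  the primitive; for \<open>y < u\<close> monotonicity is enough. The range up to
  \<open>4 * u\<close> covers both uses: the cells of ratio 4, and the points below
  \<open>2 * u\<close>.\<close>

lemma weight_doubling:
  assumes "u \<in> I" "y \<in> I" "y \<le> 4 * u"
  shows "w u \<le> 4 * C * w y"
proof (cases "u \<le> y")
  case True
  have "ennreal (u * w u) \<le> ennreal (C * y * w y)"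
    using le_primitive[OF assms(1,2) True] regular[OF assms(2)] by (rule order_trans)
  then have "u * w u \<le> C * y * w y"
    using w_pos[OF assms(2)] I_pos[OF assms(2)] C_ge_1 by (subst (asm) ennreal_le_iff) auto
  also have "\<dots> \<le> C * (4 * u) * w y"
    using assms w_pos[OF assms(2)] C_ge_1 by (intro mult_right_mono mult_left_mono) auto
  finally have "u * w u \<le> u * (4 * C * w y)"
    by (simp add: mult_ac)
  then show ?thesis
    using I_pos[OF assms(1)] by simp
next
  case False
  then have "w u \<le> 1 * w y"
    using w_antimono[OF assms(2,1)] by simp
  also have "\<dots> \<le> 4 * C * w y"
    using w_pos[OF assms(2)] C_ge_1 by (intro mult_right_mono) auto
  finally show ?thesis .
qed

section \<open>Bounding the modular M by the modular P\<close>

lemma nn_integral_submajorized_le: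
  assumes v: "v \<in> L0 I" "\<And>t. t \<in> I \<Longrightarrow> 0 \<le> v t" "submajorized I v w"
    and E: "E \<subseteq> I" "E \<in> sets lebesgue" "emeasure lebesgue E \<le> ennreal x" and x: "x \<in> I"
  shows "(\<integral>\<^sup>+ t. ennreal (v t) \<partial>lebesgue_on E) \<le> ennreal (C * x * w x)"
proof -
  have "(\<integral>\<^sup>+ t. ennreal (v t) \<partial>lebesgue_on E) = (\<integral>\<^sup>+ t. ennreal \<bar>v t\<bar> \<partial>lebesgue_on E)"
    using v(2) E(1) by (intro nn_integral_cong) auto
  also have "\<dots> \<le> (\<integral>\<^sup>+ t. rearrangement I v t \<partial>lebesgue_on {0<..<x})"
    using v E I_pos[OF x] I_sets by (intro nn_integral_le_rearrangement) auto
  also have "\<dots> \<le> (\<integral>\<^sup>+ t. rearrangement I w t \<partial>lebesgue_on {0<..<x})"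
    using v(3) x by (simp add: submajorized_def)
  also have "\<dots> \<le> primitive w x"
    unfolding primitive_def using x
    by (intro nn_integral_mono rearrangement_weight_le) (auto intro: I_down)
  finally show ?thesis
    using regular[OF x] by simp
qed

text \<open>The Jensen type inequality: integrate the pointwise bound
  \<open>P_integrand_lower_bound\<close> over \<open>E\<close>, where \<open>v\<close> has integral
  at most \<open>C * x * w x\<close> and \<open>\<bar>g\<bar>\<close> has integral at least
  \<open>s * e\<close>.\<close>

lemma P_integral_lower_bound:
  assumes \<phi>: "orlicz_function \<phi>" and g: "g \<in> L0 I"
    and v: "v \<in> L0 I" "\<And>t. t \<in> I \<Longrightarrow> 0 \<le> v t" "submajorized I v w"
    and E: "E \<subseteq> I" "E \<in> sets lebesgue" "emeasure lebesgue E \<le> ennreal x" and x: "x \<in> I"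
    and e: "ennreal e \<le> emeasure lebesgue E" "0 < e"
    and s: "\<And>t. t \<in> E \<Longrightarrow> s \<le> \<bar>g t\<bar>" "0 < s"
  shows "ennreal (\<phi> (s * e / (2 * (C * x * w x))) * (C * x * w x))
      \<le> (\<integral>\<^sup>+ t. P_integrand \<phi> (g t) (v t) * indicator E t \<partial>lebesgue_on I)"
proof -
  define Y where "Y = C * x * w x"
  \<comment> \<open>Chosen so that \<open>\<phi> z / z * s * e\<close> is twice
    \<open>\<phi> z * Y\<close>; one copy cancels against the contribution of \<open>v\<close> and
    the other is the bound.\<close>
  define z where "z = s * e / (2 * Y)"
  have Y: "0 < Y"
    unfolding Y_def using C_ge_1 I_pos[OF x] w_pos[OF x] by simp
  have z: "0 < z"
    unfolding z_def using Y e s by simp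
  have pz: "0 < \<phi> z"
    using orlicz_pos[OF \<phi> z] .
  have mE: "h \<in> borel_measurable (lebesgue_on E)" if "h \<in> L0 I" for h
    by (rule measurable_restrict_mono[OF _ E(1)]) (use that in \<open>simp add: L0_def\<close>)
  have [measurable]: "v \<in> borel_measurable (lebesgue_on E)" 
      "(\<lambda>t. P_integrand \<phi> (g t) (v t)) \<in> borel_measurable (lebesgue_on E)"
    using mE[OF g] mE[OF v(1)] v(2) E(1) by (auto intro!: borel_measurable_P_integrand[OF \<phi>])
  define A where "A = (\<integral>\<^sup>+ t. P_integrand \<phi> (g t) (v t) \<partial>lebesgue_on E)"
  have "ennreal (\<phi> z * Y) + ennreal (\<phi> z * Y) = ennreal (\<phi> z / z * s * e)"
    using Y pz z e s by (simp add: ennreal_plus[symmetric] z_def del: ennreal_plus)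
  also have "\<dots> = ennreal (\<phi> z / z * s) * ennreal e"
    using pz z s e by (intro ennreal_mult) auto
  also have "\<dots> \<le> ennreal (\<phi> z / z * s) * emeasure lebesgue E"
    by (intro mult_left_mono e) simp
  also have "\<dots> = (\<integral>\<^sup>+ t. ennreal (\<phi> z / z * s) \<partial>lebesgue_on E)"
    using E(2) by (simp add: emeasure_restrict_space)
  also have "\<dots> \<le> (\<integral>\<^sup>+ t. P_integrand \<phi> (g t) (v t) + ennreal (\<phi> z) * ennreal (v t) \<partial>lebesgue_on E)"
  proof (rule nn_integral_mono)
    fix t assume "t \<in> space (lebesgue_on E)"
    then have t: "t \<in> E" "t \<in> I"
      using E(1) by auto
    have "ennreal (\<phi> z / z * s) \<le> ennreal (\<phi> z / z * \<bar>g t\<bar>)"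
      using s(1)[OF t(1)] pz z by (intro ennreal_leI mult_left_mono) auto
    also have "\<dots> \<le> P_integrand \<phi> (g t) (v t) + ennreal (\<phi> z * v t)"
      by (rule P_integrand_lower_bound[OF \<phi> z v(2)[OF t(2)]])
    finally show "ennreal (\<phi> z / z * s) \<le> P_integrand \<phi> (g t) (v t) + ennreal (\<phi> z) * ennreal (v t)"
      using pz v(2)[OF t(2)] by (simp add: ennreal_mult)
  qed
  also have "\<dots> = A + ennreal (\<phi> z) * (\<integral>\<^sup>+ t. ennreal (v t) \<partial>lebesgue_on E)"
    unfolding A_def by (subst nn_integral_add) (auto simp: nn_integral_cmult)
  also have "\<dots> \<le> A + ennreal (\<phi> z) * ennreal Y"
    unfolding Y_def by (intro add_left_mono mult_left_mono nn_integral_submajorized_le v E x) auto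
  also have "\<dots> = A + ennreal (\<phi> z * Y)"
    using pz Y by (simp add: ennreal_mult)
  finally have "ennreal (\<phi> z * Y) \<le> A"
    by (simp add: ennreal_add_left_cancel_le add.commute[of A])
  then show ?thesis
    using nn_integral_lebesgue_on_subset[OF E(1,2) I_sets, of "\<lambda>t. P_integrand \<phi> (g t) (v t)"]
    by (simp add: A_def Y_def z_def)
qed

text \<open>An infinite value at \<open>x\<close> yields, for every height, a set of measure
  \<open>x\<close> on which \<open>\<bar>g\<bar>\<close> exceeds it. The Jensen type bound on these
  sets is unbounded, as \<open>\<phi>\<close> grows at least linearly.\<close>

lemma rearrangement_finite_if_P_integral_finite:
  assumes \<phi>: "orlicz_function \<phi>" and g: "g \<in> L0 I"
    and v: "v \<in> L0 I" "\<And>t. t \<in> I \<Longrightarrow> 0 \<le> v t" "submajorized I v w"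
    and L: "1 \<le> L"
    and fin: "(\<integral>\<^sup>+ t. P_integrand \<phi> (L * g t) (v t) \<partial>lebesgue_on I) < \<infinity>"
    and x: "x \<in> I"
  shows "rearrangement I g x < \<infinity>"
proof (rule ccontr)
  assume "\<not> ?thesis"
  then have inf: "rearrangement I g x = \<infinity>"
    by (simp add: less_top[symmetric])
  define X where "X = enn2real (\<integral>\<^sup>+ t. P_integrand \<phi> (L * g t) (v t) \<partial>lebesgue_on I)"
  define Y where "Y = C * x * w x"
  have Y: "0 < Y"
    unfolding Y_def using C_ge_1 I_pos[OF x] w_pos[OF x] by simp
  have bound: "real m * \<phi> 1 * Y \<le> X" if m: "1 \<le> m" for m :: nat
  proof -
    \<comment> \<open>Makes the argument \<open>s * x / (2 * Y)\<close> of \<open>\<phi>\<close> in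
      the lower bound equal to \<open>m\<close>.\<close>
    define s where "s = real m * (2 * Y) / x"
    have s: "0 < s"
      unfolding s_def using m Y I_pos[OF x] by simp
    define A where "A = {t \<in> I. s < \<bar>g t\<bar>}"
    have "A \<in> sets lebesgue"
      unfolding A_def using L0_abs_level_sets[OF g I_sets, of "{s<..}"] by simp
    moreover have "ennreal x < emeasure lebesgue A"
      using less_rearrangementD[of s I g x] s inf
      by (simp add: A_def distribution_function_def)
    ultimately obtain B where B: "B \<in> sets lebesgue" "B \<subseteq> A" "emeasure lebesgue B = ennreal x"
      using exists_subset_lebesgue_measure[of A x] I_pos[OF x] by auto
    have "(\<lambda>t. L * g t) \<in> L0 I"
      using g by (simp add: L0_def)
    moreover have "s \<le> \<bar>L * g t\<bar>" if "t \<in> B" for t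
    proof -
      have "1 * s \<le> L * \<bar>g t\<bar>"
        using that B(2) L s by (intro mult_mono) (auto simp: A_def)
      then show ?thesis
        using L by (simp add: abs_mult)
    qed
    ultimately have "ennreal (\<phi> (s * x / (2 * Y)) * Y)
        \<le> (\<integral>\<^sup>+ t. P_integrand \<phi> (L * g t) (v t) * indicator B t \<partial>lebesgue_on I)"
      unfolding Y_def using B I_pos[OF x] s A_def
      by (intro P_integral_lower_bound \<phi> v x) auto
    also have "\<dots> \<le> (\<integral>\<^sup>+ t. P_integrand \<phi> (L * g t) (v t) \<partial>lebesgue_on I)"
      by (intro nn_integral_mono) (auto simp: indicator_def)
    also have "\<dots> = ennreal X"
      using fin by (simp add: X_def)
    also have "s * x / (2 * Y) = real m"
      using I_pos[OF x] Y by (simp add: s_def)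
    finally have "\<phi> (real m) * Y \<le> X"
      by (subst (asm) ennreal_le_iff) (simp_all add: X_def)
    moreover have "real m * \<phi> 1 \<le> \<phi> (real m)"
      using orlicz_scale[OF \<phi>, of "1 / real m" "real m"] m by (simp add: field_simps)
    ultimately show ?thesis
      using Y by (meson mult_right_mono order_less_imp_le order_trans)
  qed
  obtain m :: nat where m: "X < real m * (\<phi> 1 * Y)"
    using reals_Archimedean3[of "\<phi> 1 * Y"] Y orlicz_pos[OF \<phi>, of 1] by auto
  moreover have "real m * (\<phi> 1 * Y) \<le> real (Suc m) * (\<phi> 1 * Y)"
    using Y orlicz_pos[OF \<phi>, of 1] by (intro mult_right_mono) auto
  ultimately show False
    using bound[of "Suc m"] by (simp add: mult.assoc)
qed

text \<open>The constant \<open>32 * C\<^sup>2\<close> is the product of \<open>4 * C\<close> from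
  doubling, \<open>C\<close> from regularity, and three factors 2: from the height
  \<open>R / 2\<close>, from the measure \<open>x / 2\<close> of the disjoint sets, and from the
  Jensen type inequality.\<close>

lemma M_modular_le_P_integral:
  assumes \<phi>: "orlicz_function \<phi>" and g: "g \<in> L0 I"
    and v: "v \<in> L0 I" "\<And>t. t \<in> I \<Longrightarrow> 0 \<le> v t" "submajorized I v w"
  shows "M_modular I \<phi> w g \<le> (\<integral>\<^sup>+ t. P_integrand \<phi> (32 * C\<^sup>2 * g t) (v t) \<partial>lebesgue_on I)"
    (is "_ \<le> ?X")
proof (cases "?X < \<infinity>")
  case False
  then show ?thesis
    by (simp add: not_less top_unique)
next
  case True
  define L where "L = 32 * C\<^sup>2"
  have "1 * 1 \<le> C * C"
    using C_ge_1 by (intro mult_mono) auto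
  then have L: "1 \<le> L" "1 \<le> C * C"
    by (auto simp: L_def power2_eq_square)
  \<comment> \<open>The rearrangement is finite on \<open>I\<close> by the previous lemma, so the
    conversion to reals loses nothing there.\<close>
  define R where "R x = enn2real (rearrangement I g x)" for x
  have R: "rearrangement I g x = ennreal (R x)" if "x \<in> I" for x
    using rearrangement_finite_if_P_integral_finite[OF \<phi> g v L(1) True[folded L_def] that]
    by (simp add: R_def)
  have R0: "0 \<le> R x" for x
    by (simp add: R_def)
  have R_antimono: "R y \<le> R x" if "x \<in> I" "y \<in> I" "x \<le> y" for x y
    using antimonoD[OF rearrangement_antimono[of I g] that(3)] R[OF that(1)] R[OF that(2)] R0
    by (simp add: ennreal_le_iff)
  define x where "x N k = 4 ^ k / (4 ^ N :: real)" for N k :: nat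
  have x0: "0 < x N k" for N k
    by (simp add: x_def)
  define J where "J N k = {x N k..<x N (Suc k)} \<inter> I" for N k
  \<comment> \<open>An upper bound of the M integrand on the cell: the rearrangement is largest at
    the left end, and the weight on the cell is at least \<open>w (x N k) / (4 * C)\<close> by
    doubling. If the left end lies outside \<open>I\<close>, the cell \<open>J N k\<close> is
    empty.\<close>
  define c where "c N k = (if x N k \<in> I
      then \<phi> (R (x N k) / (w (x N k) / (4 * C))) * (w (x N k) / (4 * C)) else 0)" for N k
  define G where "G N t = (\<Sum>k<2 * N. ennreal (c N k) * indicator (J N k) t)" for N t
  have J_sets: "J N k \<in> sets (lebesgue_on I)" for N k
    using I_sets by (auto simp: J_def sets_restrict_space)
  show ?thesis
    unfolding M_modular_def
  proof (rule nn_integral_le_eventually_bounded[of G])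
    show "G N \<in> borel_measurable (lebesgue_on I)" for N
      unfolding G_def using J_sets by measurable
    show "AE t in lebesgue_on I. \<forall>\<^sub>F N in sequentially.
        orlicz_ext \<phi> (rearrangement I g t / ennreal (w t)) * ennreal (w t) \<le> G N t"
    proof (rule AE_I2)
      fix t assume "t \<in> space (lebesgue_on I)"
      then have t: "t \<in> I"
        by simp
      show "\<forall>\<^sub>F N in sequentially.
          orlicz_ext \<phi> (rearrangement I g t / ennreal (w t)) * ennreal (w t) \<le> G N t"
        using eventually_geometric_grid[of 4 t, OF _ I_pos[OF t]]
      proof (rule eventually_mono)
        fix N :: nat
        assume "\<exists>k<2 * N. 4 ^ k / 4 ^ N \<le> t \<and> t < 4 ^ Suc k / 4 ^ N"
        then obtain k where k: "k < 2 * N" "x N k \<le> t" "t < x N (Suc k)"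
          by (auto simp: x_def)
        have xI: "x N k \<in> I"
          using I_down[OF t x0 k(2)] .
        have le: "t \<le> 4 * x N k"
          using k(3) by (simp add: x_def)
        have "orlicz_ext \<phi> (rearrangement I g t / ennreal (w t)) * ennreal (w t)
            = ennreal (\<phi> (R t / w t) * w t)"
          using R[OF t] R0[of t] w_pos[OF t] orlicz_nonneg[OF \<phi>, of "R t / w t"]
          by (simp add: divide_ennreal orlicz_ext_ennreal ennreal_mult)
        also have "\<dots> \<le> ennreal (c N k)"
        proof -
          have "\<phi> (R t / w t) * w t \<le> \<phi> (R (x N k) / w t) * w t"
            using w_pos[OF t] R0 R_antimono[OF xI t k(2)]
            by (intro mult_right_mono orlicz_mono[OF \<phi>] divide_right_mono) auto
          also have "\<dots> \<le> \<phi> (R (x N k) / (w (x N k) / (4 * C))) * (w (x N k) / (4 * C))"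
            using weight_doubling[OF xI t le] w_pos[OF xI] C_ge_1 R0
            by (intro orlicz_perspective_antimono[OF \<phi>]) (auto simp: field_simps)
          finally show ?thesis
            using xI by (simp add: c_def ennreal_leI)
        qed
        also have "\<dots> = ennreal (c N k) * indicator (J N k) t"
          using t k by (simp add: J_def)
        also have "\<dots> \<le> G N t"
          unfolding G_def using k(1) by (intro member_le_sum) auto
        finally show "orlicz_ext \<phi> (rearrangement I g t / ennreal (w t)) * ennreal (w t) \<le> G N t" .
      qed simp
    qed
    show "(\<integral>\<^sup>+ t. G N t \<partial>lebesgue_on I) \<le> ?X" for N
    proof -
      have "\<exists>B. B \<in> sets lebesgue \<and> B \<subseteq> I \<and> emeasure lebesgue B \<le> ennreal (x N k)
          \<and> (x N k \<in> I \<longrightarrow> emeasure lebesgue B = ennreal (x N k) \<and> (\<forall>t\<in>B. R (x N k) / 2 \<le> \<bar>g t\<bar>))" for k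
      proof (cases "x N k \<in> I")
        case False
        then show ?thesis
          by (intro exI[of _ "{}"]) auto
      next
        case xI: True
        \<comment> \<open>Halving a positive \<open>R\<close> puts the height strictly below the
          rearrangement, so \<open>A\<close> has measure strictly above \<open>x N k\<close>. For
          \<open>R = 0\<close> the set is all of \<open>I\<close>.\<close>
        define A where "A = {t \<in> I. R (x N k) / 2 \<le> \<bar>g t\<bar>}"
        have A: "A \<in> sets lebesgue"
          unfolding A_def using L0_abs_level_sets[OF g I_sets, of "{R (x N k) / 2..}"] by simp
        have "ennreal (x N k) < emeasure lebesgue A"
        proof (cases "R (x N k) = 0")
          case True
          then have "A = I"
            by (auto simp: A_def)
          then show ?thesis
            using less_emeasure_I[OF xI] by simp
        next
          case False
          then have "ennreal (R (x N k) / 2) < rearrangement I g (x N k)"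
            using R0[of "x N k"] by (simp add: R[OF xI] ennreal_less_iff)
          then have "ennreal (x N k) < distribution_function I g (R (x N k) / 2)"
            using R0[of "x N k"] by (intro less_rearrangementD) auto
          also have "\<dots> \<le> emeasure lebesgue A"
            unfolding distribution_function_def using A by (intro emeasure_mono) (auto simp: A_def)
          finally show ?thesis .
        qed
        then show ?thesis
          using exists_subset_lebesgue_measure[OF A, of "x N k"] x0[of N k]
          by (fastforce simp: A_def)
      qed
      then obtain B where B: "\<And>k. B k \<in> sets lebesgue" "\<And>k. B k \<subseteq> I"
          "\<And>k. emeasure lebesgue (B k) \<le> ennreal (x N k)"
          "\<And>k. x N k \<in> I \<Longrightarrow> emeasure lebesgue (B k) = ennreal (x N k)"
          "\<And>k t. x N k \<in> I \<Longrightarrow> t \<in> B k \<Longrightarrow> R (x N k) / 2 \<le> \<bar>g t\<bar>"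
        by metis
      define E where "E k = B k - (\<Union>j<k. B j)" for k
      have E: "E k \<in> sets lebesgue" "E k \<subseteq> I" "E k \<subseteq> B k" for k
        using B(1,2) by (auto simp: E_def)
      have E_disj: "disjoint_family_on E {..<2 * N}"
        unfolding disjoint_family_on_def E_def by (auto simp: linorder_neq_iff)
      \<comment> \<open>Ratio 4 makes all earlier sets together at most half as large as
        \<open>B k\<close>, so removing them leaves at least half of its measure; ratio 2 would
        leave no fixed fraction.\<close>
      have geo: "(\<Sum>j<k. x N j) \<le> x N k / 2" for k
      proof (induction k)
        case (Suc k)
        moreover have "x N (Suc k) = 4 * x N k"
          by (simp add: x_def)
        ultimately show ?case
          using x0[of N k] by simp
      qed (simp add: x0 less_imp_le)
      have E_large: "ennreal (x N k / 2) \<le> emeasure lebesgue (E k)" if xI: "x N k \<in> I" for k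
      proof -
        have "ennreal (x N k / 2) + ennreal (x N k / 2) = emeasure lebesgue (B k)"
          using B(4)[OF xI] x0[of N k] by (simp add: ennreal_plus[symmetric] del: ennreal_plus)
        also have "\<dots> \<le> emeasure lebesgue (E k \<union> (\<Union>j<k. B j))"
          using B(1) E(1) by (intro emeasure_mono sets.Un sets.finite_UN) (auto simp: E_def)
        also have "\<dots> \<le> emeasure lebesgue (E k) + emeasure lebesgue (\<Union>j<k. B j)"
          using B(1) E(1) by (intro emeasure_subadditive sets.finite_UN) auto
        also have "emeasure lebesgue (\<Union>j<k. B j) \<le> (\<Sum>j<k. emeasure lebesgue (B j))"
          using B(1) by (intro emeasure_subadditive_finite) auto
        also have "\<dots> \<le> (\<Sum>j<k. ennreal (x N j))"
          by (intro sum_mono B)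
        also have "\<dots> = ennreal (\<Sum>j<k. x N j)"
          using x0 by (intro sum_ennreal) (auto intro: less_imp_le)
        also have "\<dots> \<le> ennreal (x N k / 2)"
          by (intro ennreal_leI geo)
        finally show ?thesis
          by (simp add: ennreal_add_left_cancel_le add.commute[of "emeasure lebesgue (E k)"])
      qed
      define P where "P t = P_integrand \<phi> (L * g t) (v t)" for t
      have P_meas: "P \<in> borel_measurable (lebesgue_on I)"
        unfolding P_def using g v by (intro borel_measurable_P_integrand[OF \<phi>]) (auto simp: L0_def)
      have piece: "ennreal (c N k) * emeasure (lebesgue_on I) (J N k)
          \<le> (\<integral>\<^sup>+ t. P t * indicator (E k) t \<partial>lebesgue_on I)" for k
      proof (cases "x N k \<in> I \<and> R (x N k) \<noteq> 0")
        case False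
        then have "c N k = 0"
          using \<phi> by (auto simp: c_def orlicz_function_def)
        then show ?thesis
          by simp
      next
        case True
        define u where "u = R (x N k)"
        define y where "y = x N k"
        have y: "y \<in> I" "0 < y" and u: "0 < u"
          using True x0[of N k] R0[of "x N k"] by (auto simp: u_def y_def)
        have wy: "0 < w y"
          using w_pos y by blast
        define z where "z = u * (4 * C) / w y"
        have z: "0 \<le> z"
          using u C_ge_1 wy by (simp add: z_def)
        have c_eq: "c N k = \<phi> z * (w y / (4 * C))"
          using True by (simp add: c_def u_def y_def z_def)
        \<comment> \<open>This identity fixes the dilation \<open>L\<close>: the left side comes
          from the cell bound \<open>c\<close>, the right side is the argument of
          \<open>\<phi>\<close> in \<open>P_integral_lower_bound\<close> with height
          \<open>L * u / 2\<close> and measure \<open>y / 2\<close>.\<close>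
        have z_eq: "z = (L * u / 2) * (y / 2) / (2 * (C * y * w y))"
          using y C_ge_1 wy by (simp add: z_def L_def field_simps power2_eq_square)
        have "emeasure (lebesgue_on I) (J N k) = emeasure lebesgue (J N k)"
          using I_sets by (intro emeasure_restrict_space) (auto simp: J_def)
        also have "\<dots> \<le> emeasure lebesgue {y..<4 * y}"
          by (rule emeasure_mono) (auto simp: J_def x_def y_def)
        also have "\<dots> = ennreal (3 * y)"
          using y by simp
        finally have "ennreal (c N k) * emeasure (lebesgue_on I) (J N k)
            \<le> ennreal (c N k) * ennreal (3 * y)"
          by (rule mult_left_mono) simp
        also have "\<dots> = ennreal (\<phi> z * (w y / (4 * C)) * (3 * y))"
          unfolding c_eq using y wy C_ge_1 orlicz_nonneg[OF \<phi> z] by (intro ennreal_mult[symmetric]) auto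
        also have "\<dots> \<le> ennreal (\<phi> z * (C * y * w y))"
        proof (rule ennreal_leI)
          \<comment> \<open>The cell has length at most \<open>3 * y\<close> and its weight was
            divided by \<open>4 * C\<close>, so \<open>3 / (4 * C) \<le> C\<close> closes the
            comparison.\<close>
          have "3 \<le> 4 * (C * C)"
            using L(2) by simp
          then have "3 / (4 * C) \<le> C"
            using C_ge_1 by (simp add: field_simps)
          then have "3 / (4 * C) * (\<phi> z * w y * y) \<le> C * (\<phi> z * w y * y)"
            using orlicz_nonneg[OF \<phi> z] wy y by (intro mult_right_mono) auto
          then show "\<phi> z * (w y / (4 * C)) * (3 * y) \<le> \<phi> z * (C * y * w y)"
            by (simp add: mult_ac)
        qed
        also have "\<dots> \<le> (\<integral>\<^sup>+ t. P t * indicator (E k) t \<partial>lebesgue_on I)"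
          unfolding P_def z_eq
        proof (rule P_integral_lower_bound[OF \<phi> _ v E(2,1) _ y(1)])
          show "(\<lambda>t. L * g t) \<in> L0 I"
            using g by (simp add: L0_def)
          show "emeasure lebesgue (E k) \<le> ennreal y"
            unfolding y_def by (rule order_trans[OF emeasure_mono[OF E(3) B(1)] B(3)])
          show "ennreal (y / 2) \<le> emeasure lebesgue (E k)"
            using E_large True by (simp add: y_def)
          show "L * u / 2 \<le> \<bar>L * g t\<bar>" if "t \<in> E k" for t
            using B(5)[of k t] True that E(3) L(1) by (auto simp: u_def abs_mult)
        qed (use y u L in auto)
        finally show ?thesis .
      qed
      have "(\<integral>\<^sup>+ t. G N t \<partial>lebesgue_on I)
          = (\<Sum>k<2 * N. ennreal (c N k) * emeasure (lebesgue_on I) (J N k))"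
        unfolding G_def using J_sets by (subst nn_integral_sum) (auto simp: nn_integral_cmult_indicator)
      also have "\<dots> \<le> (\<Sum>k<2 * N. \<integral>\<^sup>+ t. P t * indicator (E k) t \<partial>lebesgue_on I)"
        by (intro sum_mono piece)
      also have "\<dots> = (\<integral>\<^sup>+ t. (\<Sum>k<2 * N. P t * indicator (E k) t) \<partial>lebesgue_on I)"
        using P_meas E(1,2) I_sets
        by (intro nn_integral_sum[symmetric] borel_measurable_times_ennreal borel_measurable_indicator)
          (auto simp: sets_restrict_space)
      also have "\<dots> \<le> (\<integral>\<^sup>+ t. P t \<partial>lebesgue_on I)"
        by (intro nn_integral_mono sum_indicator_le_disjoint E_disj) auto
      finally show ?thesis
        by (simp add: P_def L_def)
    qed
  qed
qed

section \<open>Bounding the modular P by the modular M\<close>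

lemma mem_I_if_less_emeasure:
  assumes "0 < r" "ennreal r < emeasure lebesgue I"
  shows "r \<in> I"
proof (rule ccontr)
  assume "r \<notin> I"
  then have "I \<subseteq> {0<..<r}"
    using I_pos I_down[of _ r] assms(1) by (meson greaterThanLessThan_iff not_le subsetI)
  then have "emeasure lebesgue I \<le> emeasure lebesgue {0<..<r}"
    by (intro emeasure_mono) auto
  then show False
    using assms by (simp add: not_le[symmetric])
qed

text \<open>Moving left from \<open>t\<close> to \<open>u\<close> raises the weight, which lowers
  the perspective of \<open>\<phi>\<close>. Thus one value at \<open>u\<close> serves all later
  points whose rearrangement is at least \<open>s\<close>.\<close>

lemma M_integrand_ge:
  assumes \<phi>: "orlicz_function \<phi>" and ut: "u \<in> I" "t \<in> I" "u \<le> t"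
    and s: "0 \<le> s" "ennreal s \<le> rearrangement I f t"
  shows "ennreal (\<phi> (s / w u) * w u)
      \<le> orlicz_ext \<phi> (rearrangement I f t / ennreal (w t)) * ennreal (w t)"
proof -
  have "ennreal (\<phi> (s / w u) * w u) \<le> ennreal (\<phi> (s / w t) * w t)"
    using w_antimono[OF ut] w_pos[OF ut(2)] s(1)
    by (intro ennreal_leI orlicz_perspective_antimono[OF \<phi>]) auto
  also have "\<dots> = orlicz_ext \<phi> (ennreal s / ennreal (w t)) * ennreal (w t)"
    using s(1) w_pos[OF ut(2)] orlicz_nonneg[OF \<phi>, of "s / w t"]
    by (simp add: divide_ennreal orlicz_ext_ennreal ennreal_mult)
  also have "\<dots> \<le> orlicz_ext \<phi> (rearrangement I f t / ennreal (w t)) * ennreal (w t)"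
    by (intro mult_right_mono orlicz_ext_mono[OF \<phi>] divide_right_mono_ennreal s) simp
  finally show ?thesis .
qed

text \<open>An infinite level set forces \<open>I\<close> to have infinite length and the
  rearrangement to stay above \<open>s\<close> throughout. The M integrand then exceeds a positive
  constant on the part of \<open>I\<close> from \<open>x\<close> on.\<close>

lemma level_sets_finite_if_M_modular_finite:
  assumes \<phi>: "orlicz_function \<phi>" and f: "f \<in> L0 I"
    and fin: "M_modular I \<phi> w f < \<infinity>" and s: "0 < s"
  shows "emeasure lebesgue {t \<in> I. s \<le> \<bar>f t\<bar>} < \<infinity>"
proof (rule ccontr)
  assume "\<not> ?thesis"
  then have inf: "emeasure lebesgue {t \<in> I. s \<le> \<bar>f t\<bar>} = \<infinity>"
    by (simp add: less_top[symmetric])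
  then have "I \<noteq> {}"
    by auto
  then obtain x where x: "x \<in> I"
    by blast
  define q where "q = \<phi> (s / w x) * w x"
  have q: "0 < q"
    using w_pos[OF x] orlicz_pos[OF \<phi>, of "s / w x"] s by (simp add: q_def)
  have J: "I - {0<..<x} \<in> sets lebesgue" "I - {0<..<x} \<in> sets (lebesgue_on I)"
    using I_sets by (auto simp: sets_restrict_space)
  have "\<infinity> \<le> emeasure lebesgue I"
    using inf emeasure_mono[of "{t \<in> I. s \<le> \<bar>f t\<bar>}" I lebesgue] I_sets by auto
  also have "\<dots> \<le> emeasure lebesgue ({0<..<x} \<union> (I - {0<..<x}))"
    using I_sets by (intro emeasure_mono) auto
  also have "\<dots> \<le> emeasure lebesgue {0<..<x} + emeasure lebesgue (I - {0<..<x})"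
    using J by (intro emeasure_subadditive) auto
  finally have J_inf: "emeasure lebesgue (I - {0<..<x}) = \<infinity>"
    using I_pos[OF x] by (simp add: top_unique)
  have "\<infinity> = ennreal q * emeasure (lebesgue_on I) (I - {0<..<x})"
    using J_inf q I_sets by (simp add: emeasure_restrict_space ennreal_mult_top)
  also have "\<dots> = (\<integral>\<^sup>+ t. ennreal q * indicator (I - {0<..<x}) t \<partial>lebesgue_on I)"
    using J by (intro nn_integral_cmult_indicator[symmetric])
  also have "\<dots> \<le> M_modular I \<phi> w f"
    unfolding M_modular_def
  proof (rule nn_integral_mono)
    fix t assume "t \<in> space (lebesgue_on I)"
    then have t: "t \<in> I"
      by simp
    have "ennreal s \<le> rearrangement I f t"
      using inf by (intro le_rearrangement f I_sets) simp
    then show "ennreal q * indicator (I - {0<..<x}) t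
        \<le> orlicz_ext \<phi> (rearrangement I f t / ennreal (w t)) * ennreal (w t)"
      using M_integrand_ge[OF \<phi> x t, of s f] s t I_pos[OF t]
      by (cases "x \<le> t") (auto simp: q_def indicator_def)
  qed
  finally show False
    using fin by (simp add: top_unique)
qed

text \<open>The constant \<open>8 * C\<close> is 2 from the dyadic rounding
  \<open>\<bar>f t\<bar> \<le> 2 * x N k\<close>, times \<open>4 * C\<close> from the denominator of
  the competitor \<open>v\<close>.\<close>

lemma P_modular_le_M_modular:
  assumes \<phi>: "orlicz_function \<phi>" and f: "f \<in> L0 I"
  shows "P_modular I \<phi> w (\<lambda>t. f t / (8 * C)) \<le> M_modular I \<phi> w f"
proof (cases "M_modular I \<phi> w f < \<infinity>")
  case False
  then show ?thesis
    by (simp add: not_less top_unique)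
next
  case fin: True
  define b where "b s = measure lebesgue {t \<in> I. s \<le> \<bar>f t\<bar>}" for s
  have level: "{t \<in> I. s \<le> \<bar>f t\<bar>} \<in> sets lebesgue" for s
    using L0_abs_level_sets[OF f I_sets, of "{s..}"] by simp
  have b: "emeasure lebesgue {t \<in> I. s \<le> \<bar>f t\<bar>} = ennreal (b s)" if "0 < s" for s
    unfolding b_def using level_sets_finite_if_M_modular_finite[OF \<phi> f fin that]
    by (intro emeasure_eq_ennreal_measure) auto
  have b0: "0 \<le> b s" for s
    by (simp add: b_def)
  have b_antimono: "b s' \<le> b s" if "0 < s" "s \<le> s'" for s s'
  proof -
    have "ennreal (b s') \<le> ennreal (b s)"
      using that by (subst (1 2) b[symmetric]) (auto intro!: emeasure_mono level)
    then show ?thesis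
      using b0 by (simp add: ennreal_le_iff)
  qed
  have below_b: "r \<in> I" if "0 < r" "r < b s" "0 < s" for r s
  proof (rule mem_I_if_less_emeasure)
    have "ennreal r < ennreal (b s)"
      using that by (simp add: ennreal_less_iff)
    also have "\<dots> \<le> emeasure lebesgue I"
      using that by (subst b[symmetric]) (auto intro!: emeasure_mono I_sets)
    finally show "ennreal r < emeasure lebesgue I" .
  qed fact
  have half_b: "b s / 2 \<in> I" if "0 < s" "0 < b s" for s
    using that by (intro below_b[of _ s]) auto
  define T where "T = {s. 0 < s \<and> 0 < b s}"
  \<comment> \<open>\<open>w\<close> is evaluated at half of \<open>b s\<close> because
    \<open>b s\<close> itself may be the right end of \<open>I\<close>. Outside \<open>T\<close> the
    value 0 concerns only zeros of \<open>f\<close> and a null set.\<close>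
  define H where "H s = (if s \<in> T then w (b s / 2) / (4 * C) else 0)" for s
  define v where "v t = H \<bar>f t\<bar>" for t
  have H_pos: "0 < H s" if "s \<in> T" for s
    using that half_b w_pos C_ge_1 by (auto simp: H_def T_def)
  have H_nonneg: "0 \<le> H s" for s
    using H_pos[of s] by (cases "s \<in> T") (auto simp: H_def)
  have H_mono: "H s \<le> H s'" if "s \<in> T" "s' \<in> T" "s \<le> s'" for s s'
  proof -
    have "w (b s / 2) \<le> w (b s' / 2)"
      using that half_b b_antimono[of s s'] by (intro w_antimono) (auto simp: T_def)
    then show ?thesis
      using that C_ge_1 by (simp add: H_def divide_right_mono)
  qed
  have T_borel: "T \<in> sets borel"
  proof (rule sets_borel_is_interval, unfold is_interval_1, safe)
    fix s s' r assume "s \<in> T" "s' \<in> T" "s \<le> r" "r \<le> s'"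
    then show "r \<in> T"
      using b_antimono[of r s'] by (auto simp: T_def)
  qed
  \<comment> \<open>A higher level has a smaller level set and hence a larger weight, so
    \<open>H\<close> is monotone on the interval \<open>T\<close> and therefore Borel.\<close>
  have "mono_on T (\<lambda>s. w (b s / 2) / (4 * C))"
    using H_mono by (auto simp: monotone_on_def H_def)
  then have H_borel: "H \<in> borel_measurable borel"
    unfolding H_def using T_borel
    by (subst measurable_If_restrict_space_iff) (auto intro: borel_measurable_mono_on_fnc)
  then have v_L0: "v \<in> L0 I"
    using f unfolding v_def L0_def by (intro measurable_compose[OF _ H_borel] borel_measurable_abs)
  have v_nonneg: "0 \<le> v t" for t
    by (simp add: v_def H_nonneg)
  have w_L0: "w \<in> L0 I"
    using weight by (simp add: weight_function_def)
  have "distribution_function I v c \<le> distribution_function I w c" if c: "0 \<le> c" for c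
  proof -
    \<comment> \<open>\<open>v\<close> exceeds \<open>c\<close> only where
      \<open>\<bar>f\<bar>\<close> lies in \<open>S\<close>. For \<open>s\<close> in
      \<open>S\<close>, doubling gives \<open>w > c\<close> on all of \<open>{0<..<b s}\<close>, so
      each level set obeys the bound and so does their union.\<close>
    define S where "S = {s \<in> T. c < H s}"
    have S: "emeasure lebesgue {t \<in> I. s \<le> \<bar>f t\<bar>} \<le> distribution_function I w c" if s: "s \<in> S" for s
    proof -
      have s': "0 < s" "0 < b s" "c < w (b s / 2) / (4 * C)"
        using s by (auto simp: S_def T_def H_def)
      have "{0<..<b s} \<subseteq> {t \<in> I. c < \<bar>w t\<bar>}"
      proof
        fix r assume r: "r \<in> {0<..<b s}"
        then have rI: "r \<in> I"
          using below_b s' by auto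
        have "w (b s / 2) \<le> 4 * C * w r"
          using r s' half_b rI by (intro weight_doubling) auto
        moreover have "4 * C * c < w (b s / 2)"
          using s'(3) C_ge_1 by (simp add: field_simps)
        ultimately have "4 * C * c < 4 * C * w r"
          by linarith
        then have "c < w r"
          using C_ge_1 by simp
        then show "r \<in> {t \<in> I. c < \<bar>w t\<bar>}"
          using rI by auto
      qed
      then have "emeasure lebesgue {0<..<b s} \<le> distribution_function I w c"
        unfolding distribution_function_def using L0_abs_level_sets[OF w_L0 I_sets, of "{c<..}"]
        by (intro emeasure_mono) auto
      then show ?thesis
        using s' by (simp add: b)
    qed
    have "0 \<le> s" if "s \<in> S" for s
      using that by (auto simp: S_def T_def)
    then have US: "{t \<in> I. \<exists>s\<in>S. s \<le> \<bar>f t\<bar>} \<in> sets lebesgue"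
        "emeasure lebesgue {t \<in> I. \<exists>s\<in>S. s \<le> \<bar>f t\<bar>} \<le> distribution_function I w c"
      using emeasure_upper_level_set_le[OF f I_sets, of S] S by blast+
    have "{t \<in> I. c < \<bar>v t\<bar>} \<subseteq> {t \<in> I. \<exists>s\<in>S. s \<le> \<bar>f t\<bar>}"
    proof safe
      fix t assume "c < \<bar>v t\<bar>"
      then have "\<bar>f t\<bar> \<in> S"
        using c H_nonneg by (auto simp: S_def v_def H_def split: if_splits)
      then show "\<exists>s\<in>S. s \<le> \<bar>f t\<bar>"
        by blast
    qed
    then have "distribution_function I v c \<le> emeasure lebesgue {t \<in> I. \<exists>s\<in>S. s \<le> \<bar>f t\<bar>}"
      unfolding distribution_function_def using US(1) by (intro emeasure_mono)
    then show ?thesis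
      using US(2) by (rule order_trans)
  qed
  then have "submajorized I v w"
    unfolding submajorized_def by (intro ballI nn_integral_mono rearrangement_mono_distribution)
  then have "P_modular I \<phi> w (\<lambda>t. f t / (8 * C))
      \<le> (\<integral>\<^sup>+ t. P_integrand \<phi> (f t / (8 * C)) (v t) \<partial>lebesgue_on I)"
    unfolding P_modular_def using v_L0 v_nonneg by (intro INF_lower) auto
  also have "\<dots> \<le> M_modular I \<phi> w f"
  proof -
    define x where "x N k = 2 ^ k / (2 ^ N :: real)" for N k :: nat
    have x0: "0 < x N k" for N k
      by (simp add: x_def)
    have x_mono: "x N j \<le> x N k" if "j \<le> k" for N j k
      unfolding x_def using that by (intro divide_right_mono power_increasing) auto
    define E where "E N k = {t \<in> I. x N k \<le> \<bar>f t\<bar> \<and> \<bar>f t\<bar> < x N (Suc k)}" for N k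
    define d where "d N k = b (x N k)" for N k
    have d0: "0 \<le> d N k" for N k
      by (simp add: d_def b0)
    have d_antimono: "d N k \<le> d N j" if "j \<le> k" for N j k
      unfolding d_def using b_antimono x0 x_mono that by blast
    have half_d: "d N k / 2 \<in> I" if "0 < d N k" for N k
      using half_b x0 that by (auto simp: d_def)
    \<comment> \<open>Half the lower bound of the M integrand on \<open>J N k\<close>. The half is
      affordable because \<open>v\<close> carries the factor \<open>1 / (4 * C)\<close>, and it pays
      for \<open>J N k\<close> having only half the measure of \<open>E N k\<close>.\<close>
    define c where "c N k = (if 0 < d N k
        then \<phi> (x N k / w (d N k / 2)) * w (d N k / 2) / 2 else 0)" for N k
    have c0: "0 \<le> c N k" for N k
    proof (cases "0 < d N k")
      case True
      then have "0 \<le> x N k / w (d N k / 2)"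
        using w_pos[OF half_d[OF True]] x0[of N k] by simp
      then show ?thesis
        using w_pos[OF half_d[OF True]] orlicz_nonneg[OF \<phi>] by (simp add: c_def)
    qed (simp add: c_def)
    \<comment> \<open>Keeping only points above \<open>d N k / 2\<close> ensures that the weight
      there is at most \<open>w (d N k / 2)\<close>.\<close>
    define J where "J N k = {max (d N (Suc k)) (d N k / 2)..<d N k} \<inter> I" for N k
    define G where "G N t = (\<Sum>k<2 * N. ennreal (c N k) * indicator (E N k) t)" for N t
    have E_eq: "E N k = {t \<in> I. x N k \<le> \<bar>f t\<bar>} - {t \<in> I. x N (Suc k) \<le> \<bar>f t\<bar>}" for N k
      by (auto simp: E_def)
    have E_sets: "E N k \<in> sets (lebesgue_on I)" for N k
      using level I_sets E_eq by (auto simp: sets_restrict_space)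
    have J_sets: "J N k \<in> sets (lebesgue_on I)" for N k
      using I_sets by (auto simp: J_def sets_restrict_space)
    have J_disj: "disjoint_family_on (J N) {..<2 * N}" for N
    proof -
      have "J N j \<inter> J N k = {}" if "j < k" for j k
        using d_antimono[of "Suc j" k N] that by (auto simp: J_def)
      then show ?thesis
        unfolding disjoint_family_on_def by (metis inf_commute linorder_neqE_nat)
    qed
    show ?thesis
    proof (rule nn_integral_le_eventually_bounded[of G])
      show "G N \<in> borel_measurable (lebesgue_on I)" for N
        unfolding G_def using E_sets by measurable
      \<comment> \<open>On \<open>Z\<close> the competitor vanishes while \<open>f\<close> does not,
        so the P integrand is infinite; \<open>Z\<close> is null as a union of null level
        sets.\<close>
      define Z where "Z = {t \<in> I. \<exists>s\<in>{s. 0 < s \<and> b s = 0}. s \<le> \<bar>f t\<bar>}"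
      have "Z \<in> sets lebesgue \<and> emeasure lebesgue Z \<le> 0"
        unfolding Z_def by (rule emeasure_upper_level_set_le[OF f I_sets]) (auto simp: b)
      then have "Z \<in> null_sets (lebesgue_on I)"
        using I_sets by (auto simp: null_sets_restrict_space Z_def)
      then show "AE t in lebesgue_on I. \<forall>\<^sub>F N in sequentially.
          P_integrand \<phi> (f t / (8 * C)) (v t) \<le> G N t"
      proof (rule AE_I', safe, goal_cases)
        case (1 t)
        then have t: "t \<in> I"
          by simp
        show "t \<in> Z"
        proof (rule ccontr)
          assume "t \<notin> Z"
          have "\<forall>\<^sub>F N in sequentially. P_integrand \<phi> (f t / (8 * C)) (v t) \<le> G N t"
          \<comment> \<open>At a zero of \<open>f\<close> the competitor is also 0, and the
            convention gives the integrand 0.\<close>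
          proof (cases "f t = 0")
            case True
            then have "v t = 0"
              by (simp add: v_def H_def T_def)
            then show ?thesis
              using True by (simp add: P_integrand_def)
          next
            case False
            then have "b \<bar>f t\<bar> \<noteq> 0"
              using \<open>t \<notin> Z\<close> t by (auto simp: Z_def)
            then have fT: "\<bar>f t\<bar> \<in> T"
              using False b0[of "\<bar>f t\<bar>"] by (simp add: T_def)
            have "0 < \<bar>f t\<bar>"
              using False by simp
            from eventually_geometric_grid[of 2, OF _ this]
            show ?thesis
            proof (rule eventually_mono)
              fix N :: nat
              assume "\<exists>k<2 * N. 2 ^ k / 2 ^ N \<le> \<bar>f t\<bar> \<and> \<bar>f t\<bar> < 2 ^ Suc k / 2 ^ N"
              then obtain k where k: "k < 2 * N" "x N k \<le> \<bar>f t\<bar>" "\<bar>f t\<bar> < x N (Suc k)"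
                by (auto simp: x_def)
              define y where "y = w (d N k / 2)"
              have dk: "0 < d N k"
                using fT b_antimono[OF x0 k(2)] by (auto simp: d_def T_def)
              then have xT: "x N k \<in> T"
                using x0 by (simp add: T_def d_def)
              have y: "0 < y"
                unfolding y_def using w_pos half_d dk by blast
              have "H (x N k) = y / (4 * C)"
                using xT by (simp add: H_def y_def d_def)
              then have yv: "y / (4 * C) \<le> v t"
                using H_mono[OF xT fT k(2)] by (simp add: v_def)
              have "\<bar>f t\<bar> \<le> 2 * x N k"
                using k(3) by (simp add: x_def)
              then have "\<bar>f t / (8 * C)\<bar> \<le> \<bar>2 * x N k / (8 * C)\<bar>"
                using divide_right_mono[of "\<bar>f t\<bar>" "2 * x N k" "8 * C"] C_ge_1 x0[of N k] by simp
              then have "P_integrand \<phi> (f t / (8 * C)) (v t)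
                  \<le> P_integrand \<phi> (2 * x N k / (8 * C)) (y / (4 * C))"
                using yv y C_ge_1 by (intro P_integrand_mono[OF \<phi>]) auto
              also have "\<dots> = ennreal (\<phi> (x N k / y) * (y / (4 * C)))"
                using y C_ge_1 x0[of N k] by (simp add: P_integrand_pos)
              also have "\<dots> \<le> ennreal (c N k)"
              proof (rule ennreal_leI)
                have "y / (4 * C) \<le> y / 2"
                  using y C_ge_1 by (intro divide_left_mono) auto
                then have "\<phi> (x N k / y) * (y / (4 * C)) \<le> \<phi> (x N k / y) * (y / 2)"
                  using y x0[of N k] by (intro mult_left_mono orlicz_nonneg[OF \<phi>]) auto
                then show "\<phi> (x N k / y) * (y / (4 * C)) \<le> c N k"
                  using dk by (simp add: c_def y_def)
              qed
              also have "\<dots> = ennreal (c N k) * indicator (E N k) t"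
                using t k by (simp add: E_def)
              also have "\<dots> \<le> G N t"
                unfolding G_def using k(1) by (intro member_le_sum) auto
              finally show "P_integrand \<phi> (f t / (8 * C)) (v t) \<le> G N t" .
            qed simp
          qed
          then show False
            using 1 by simp
        qed
      qed
      show "(\<integral>\<^sup>+ t. G N t \<partial>lebesgue_on I) \<le> M_modular I \<phi> w f" for N
      proof -
        have piece: "ennreal (c N k) * emeasure (lebesgue_on I) (E N k)
            \<le> ennreal (2 * c N k) * emeasure (lebesgue_on I) (J N k)" for k
        proof (cases "0 < d N k")
          case False
          then show ?thesis
            by (simp add: c_def)
        next
          case True
          have "emeasure (lebesgue_on I) (E N k) = emeasure lebesgue (E N k)"
            using I_sets by (intro emeasure_restrict_space) (auto simp: E_def)
          also have "\<dots> = ennreal (d N k) - ennreal (d N (Suc k))"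
            unfolding E_eq d_def using level b x0 x_mono[of k "Suc k" N]
            by (subst emeasure_Diff) auto
          also have "\<dots> = ennreal (d N k - d N (Suc k))"
            using d0 by (simp add: ennreal_minus)
          \<comment> \<open>If the maximum is \<open>d N (Suc k)\<close> nothing was cut off;
            otherwise \<open>d N k / 2\<close> remains, at least half of the difference.\<close>
          also have "\<dots> \<le> ennreal (2 * (d N k - max (d N (Suc k)) (d N k / 2)))"
            using d_antimono[of k "Suc k" N] d0[of N "Suc k"] by (intro ennreal_leI) auto
          also have "\<dots> = 2 * emeasure lebesgue {max (d N (Suc k)) (d N k / 2)..<d N k}"
            using d_antimono[of k "Suc k" N] d0[of N k]
            by (simp add: ennreal_mult' del: right_diff_distrib_numeral)
          \<comment> \<open>Every positive point below \<open>d N k\<close> lies in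
            \<open>I\<close>, and \<open>d N k / 2\<close> is positive.\<close>
          also have "{max (d N (Suc k)) (d N k / 2)..<d N k} = J N k"
            unfolding J_def using True below_b[OF _ _ x0[of N k]]
            by (auto simp: d_def)
          also have "emeasure lebesgue (J N k) = emeasure (lebesgue_on I) (J N k)"
            using I_sets by (intro emeasure_restrict_space[symmetric]) (auto simp: J_def)
          finally have "ennreal (c N k) * emeasure (lebesgue_on I) (E N k)
              \<le> ennreal (c N k) * (2 * emeasure (lebesgue_on I) (J N k))"
            by (intro mult_left_mono) auto
          then show ?thesis
            using c0 by (simp add: ennreal_mult mult_ac)
        qed
        have "(\<integral>\<^sup>+ t. G N t \<partial>lebesgue_on I)
            = (\<Sum>k<2 * N. ennreal (c N k) * emeasure (lebesgue_on I) (E N k))"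
          unfolding G_def using E_sets by (subst nn_integral_sum) (auto simp: nn_integral_cmult_indicator)
        also have "\<dots> \<le> (\<Sum>k<2 * N. ennreal (2 * c N k) * emeasure (lebesgue_on I) (J N k))"
          by (intro sum_mono piece)
        also have "\<dots> = (\<integral>\<^sup>+ t. (\<Sum>k<2 * N. ennreal (2 * c N k) * indicator (J N k) t) \<partial>lebesgue_on I)"
          using J_sets by (subst nn_integral_sum) (auto simp: nn_integral_cmult_indicator)
        also have "\<dots> \<le> M_modular I \<phi> w f"
          unfolding M_modular_def
        proof (intro nn_integral_mono sum_indicator_le_disjoint J_disj)
          fix t k assume tJ: "t \<in> J N k"
          then have t: "t \<in> I" "d N k / 2 \<le> t" "t < d N k" "0 < d N k"
            using I_pos[of t] by (auto simp: J_def)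
          have "ennreal t < ennreal (d N k)"
            using t I_pos[OF t(1)] by (simp add: ennreal_less_iff)
          then have "ennreal (x N k) \<le> rearrangement I f t"
            using b[OF x0] by (intro le_rearrangement f I_sets) (simp add: d_def)
          then show "ennreal (2 * c N k)
              \<le> orlicz_ext \<phi> (rearrangement I f t / ennreal (w t)) * ennreal (w t)"
            using M_integrand_ge[OF \<phi> half_d[OF t(4)] t(1,2), of "x N k" f] x0[of N k] t(4)
            by (simp add: c_def)
        qed simp
        finally show ?thesis .
      qed
    qed
  qed
  finally show ?thesis .
qed

section \<open>From modulars to norms and classes\<close>

lemma M_modular_le_P_modular:
  assumes \<phi>: "orlicz_function \<phi>" and f: "f \<in> L0 I"
  shows "M_modular I \<phi> w (\<lambda>t. f t / (32 * C\<^sup>2)) \<le> P_modular I \<phi> w f"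
  unfolding P_modular_def
proof (rule INF_greatest)
  fix v assume v: "v \<in> {v \<in> L0 I. (\<forall>t\<in>I. 0 \<le> v t) \<and> submajorized I v w}"
  have "(\<lambda>t. f t / (32 * C\<^sup>2)) \<in> L0 I"
    using f by (simp add: L0_def)
  then have "M_modular I \<phi> w (\<lambda>t. f t / (32 * C\<^sup>2))
      \<le> (\<integral>\<^sup>+ t. P_integrand \<phi> (32 * C\<^sup>2 * (f t / (32 * C\<^sup>2))) (v t) \<partial>lebesgue_on I)"
    using v by (intro M_modular_le_P_integral \<phi>) auto
  then show "M_modular I \<phi> w (\<lambda>t. f t / (32 * C\<^sup>2))
      \<le> (\<integral>\<^sup>+ t. P_integrand \<phi> (f t) (v t) \<partial>lebesgue_on I)"
    using C_ge_1 by simp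
qed

lemma M_norm_le_calM_norm:
  assumes \<phi>: "orlicz_function \<phi>" and f: "f \<in> L0 I"
  shows "M_norm I \<phi> w f \<le> ennreal (32 * C\<^sup>2) * calM_norm I \<phi> w f"
  unfolding M_norm_def calM_norm_def
proof (rule luxemburg_norm_le)
  fix e :: real
  have "(\<lambda>t. f t / e) \<in> L0 I"
    using f by (simp add: L0_def)
  from M_modular_le_P_modular[OF \<phi> this]
  show "M_modular I \<phi> w (\<lambda>t. f t / (32 * C\<^sup>2 * e)) \<le> P_modular I \<phi> w (\<lambda>t. f t / e)"
    by (simp add: mult.commute)
qed (use C_ge_1 in simp)

lemma calM_norm_le_M_norm:
  assumes \<phi>: "orlicz_function \<phi>" and f: "f \<in> L0 I"
  shows "calM_norm I \<phi> w f \<le> ennreal (8 * C) * M_norm I \<phi> w f"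
  unfolding M_norm_def calM_norm_def
proof (rule luxemburg_norm_le)
  fix e :: real
  have "(\<lambda>t. f t / e) \<in> L0 I"
    using f by (simp add: L0_def)
  from P_modular_le_M_modular[OF \<phi> this]
  show "P_modular I \<phi> w (\<lambda>t. f t / (8 * C * e)) \<le> M_modular I \<phi> w (\<lambda>t. f t / e)"
    by (simp add: mult.commute)
qed (use C_ge_1 in simp)

text \<open>Membership in \<open>M_class\<close> asks for a finite modular, whereas the norm asks
  for a modular of at most 1. The gap is bridged on the P side, where dividing by \<open>c\<close>
  divides the bound by \<open>c\<close>.\<close>

lemma calM_norm_finite_if_M_modular_finite:
  assumes \<phi>: "orlicz_function \<phi>" and f: "f \<in> L0 I"
    and l: "0 < l" "M_modular I \<phi> w (\<lambda>t. l * f t) < \<infinity>"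
  shows "calM_norm I \<phi> w f < \<infinity>"
proof -
  define g where "g = (\<lambda>t. l * f t / (8 * C))"
  have g: "g \<in> L0 I"
    using f by (simp add: L0_def g_def)
  have "(\<lambda>t. l * f t) \<in> L0 I"
    using f by (simp add: L0_def)
  from P_modular_le_M_modular[OF \<phi> this]
  have P_fin: "P_modular I \<phi> w g < \<infinity>"
    using l(2) by (auto simp: g_def intro: le_less_trans)
  define c where "c = max 1 (enn2real (P_modular I \<phi> w g))"
  have c: "1 \<le> c" "P_modular I \<phi> w g \<le> ennreal c"
    using P_fin by (auto simp: c_def ennreal_enn2real_if intro!: ennreal_leI split: if_splits)
      (metis P_fin ennreal_enn2real ennreal_leI infinity_ennreal_def max.cobounded2)
  \<comment> \<open>Chosen so that \<open>f t / e\<close> equals \<open>g t / c\<close>.\<close>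
  define e where "e = c * (8 * C) / l"
  have e: "0 < e"
    using c l(1) C_ge_1 by (simp add: e_def)
  have "P_modular I \<phi> w (\<lambda>t. f t / e) = P_modular I \<phi> w (\<lambda>t. g t / c)"
    using c l(1) C_ge_1 by (simp add: g_def e_def field_simps)
  also have "\<dots> \<le> ennreal (1 / c) * P_modular I \<phi> w g"
    by (rule P_modular_scale[OF \<phi> g c(1)])
  also have "\<dots> \<le> ennreal (1 / c) * ennreal c"
    by (intro mult_left_mono c) simp
  also have "\<dots> = 1"
    using c(1) by (simp add: ennreal_mult[symmetric])
  finally have "calM_norm I \<phi> w f \<le> ennreal e"
    unfolding calM_norm_def using e by (intro INF_lower) auto
  then show ?thesis
    by (auto intro: le_less_trans)
qed

text \<open>One inclusion passes through the norms: a finite M norm provides an admissible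
  \<open>e\<close>, and \<open>1 / e\<close> is the required scale. The other is the preceding
  lemma.\<close>

lemma calM_class_eq_M_class:
  assumes \<phi>: "orlicz_function \<phi>"
  shows "calM_class I \<phi> w = M_class I \<phi> w"
proof (intro equalityI subsetI)
  fix f assume "f \<in> calM_class I \<phi> w"
  then have f: "f \<in> L0 I" and fin: "calM_norm I \<phi> w f < \<infinity>"
    by (auto simp: calM_class_def)
  have "M_norm I \<phi> w f < \<infinity>"
    using le_less_trans[OF M_norm_le_calM_norm[OF \<phi> f], of \<infinity>] fin
    by (simp add: ennreal_mult_less_top)
  then obtain e where e: "0 < e" "M_modular I \<phi> w (\<lambda>t. f t / e) \<le> 1"
    unfolding M_norm_def INF_less_iff by auto
  then have "M_modular I \<phi> w (\<lambda>t. 1 / e * f t) < \<infinity>"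
    by (auto intro: le_less_trans)
  then show "f \<in> M_class I \<phi> w"
    using f e(1) unfolding M_class_def by (intro CollectI conjI exI[of _ "1 / e"]) auto
next
  fix f assume "f \<in> M_class I \<phi> w"
  then show "f \<in> calM_class I \<phi> w"
    using calM_norm_finite_if_M_modular_finite[OF \<phi>] by (auto simp: M_class_def calM_class_def)
qed

lemma equivalent_calM_norm_M_norm:
  assumes \<phi>: "orlicz_function \<phi>"
  shows "equivalent_functionals_on (L0 I) (calM_norm I \<phi> w) (M_norm I \<phi> w)"
  unfolding equivalent_functionals_on_def
proof (intro exI[of _ "32 * C\<^sup>2"] conjI ballI)
  show "0 < 32 * C\<^sup>2"
    using C_ge_1 by simp
  fix f assume f: "f \<in> L0 I"
  show "M_norm I \<phi> w f \<le> ennreal (32 * C\<^sup>2) * calM_norm I \<phi> w f"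
    by (rule M_norm_le_calM_norm[OF \<phi> f])
  \<comment> \<open>The larger of the two norm constants serves for both directions, as
    \<open>1 \<le> C\<close>.\<close>
  have "8 * C * 1 \<le> 8 * C * (4 * C)"
    using C_ge_1 by (intro mult_left_mono) auto
  then have C: "8 * C \<le> 32 * C\<^sup>2"
    by (simp add: power2_eq_square)
  have "calM_norm I \<phi> w f \<le> ennreal (32 * C\<^sup>2) * M_norm I \<phi> w f"
    using calM_norm_le_M_norm[OF \<phi> f] mult_right_mono[OF ennreal_leI[OF C]]
    by (rule order_trans) simp
  then have "ennreal (1 / (32 * C\<^sup>2)) * calM_norm I \<phi> w f
      \<le> ennreal (1 / (32 * C\<^sup>2)) * (ennreal (32 * C\<^sup>2) * M_norm I \<phi> w f)"
    by (rule mult_left_mono) simp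
  also have "\<dots> = M_norm I \<phi> w f"
    using C_ge_1 by (simp add: mult.assoc[symmetric] ennreal_mult[symmetric])
  finally show "ennreal (1 / (32 * C\<^sup>2)) * calM_norm I \<phi> w f \<le> M_norm I \<phi> w f" .
qed

end

theorem proposition4p3:
  fixes \<phi> w :: "real \<Rightarrow> real" and a :: ereal and I :: "real set"
  assumes "orlicz_function \<phi>"
    and "0 < a"
    and "I = einterval 0 a"
    and "weight_function I w"
    and "\<forall>t\<in>I. 0 < w t"
    and "regular_weight I w"
  shows "calM_class I \<phi> w = M_class I \<phi> w
       \<and> equivalent_functionals_on (L0 I) (calM_norm I \<phi> w) (M_norm I \<phi> w)"
proof -
  obtain D where D: "0 < D" "\<And>u. u \<in> I \<Longrightarrow> primitive w u \<le> ennreal (D * u * w u)"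
    using assms(6) by (auto simp: regular_weight_def)
  have pos: "0 < u" if "u \<in> I" for u
    using that by (simp add: assms(3) einterval_def zero_ereal_def)
  \<comment> \<open>The maximum with 1 achieves the normalisation of the regularity
    constant.\<close>
  interpret regular_weight_on_interval I a w "max 1 D"
  proof
    fix u assume u: "u \<in> I"
    have "D * u * w u \<le> max 1 D * u * w u"
      using u assms(5) pos[OF u] by (intro mult_right_mono) auto
    then show "primitive w u \<le> ennreal (max 1 D * u * w u)"
      using D(2)[OF u] by (auto intro: order_trans ennreal_leI)
  qed (use assms in auto)
  show ?thesis
    using calM_class_eq_M_class equivalent_calM_norm_M_norm assms(1) by blast
qed

end
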